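(* Let $q$ be a prime power and let $G=\mathrm{PSL}(2,q)$. Then the power graph of $G$ is a chordal graph if and only if the following holds: (a) if $q$ is even, each of $q+1$ and $q-1$ is either a power of some prime or a product of a prime and a prime power; (b) if $q$ is odd, each of $(q+1)/2$ and $(q-1)/2$ is either a prime power or a product of a prime and a prime power.
   Context: The power graph $\mathcal{P}(G)$ of a group $G$ is the undirected simple graph with vertex set $G$ in which distinct $a,b$ are adjacent iff $a=b^m$ or $b=a^n$ for some positive integers $m,n$. A graph is chordal if it has no induced cycle of length $4$ or more. In conditions (a) and (b), $1=p^0$ is counted as a prime power. *)

theory Defs
  imports
    "HOL-Analysis.Determinants"
    "HOL-Algebra.Coset"
    "HOL-Number_Theory.Prime_Powers"
begin

section \<open>Chordal graphs\<close>

text \<open>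
  A simple graph is given by its vertex set and a symmetric, irreflexive adjacency relation.
  The ``iff'' in the third conjunct says both that consecutive vertices are adjacent and that the
  cycle has no chord. For lists of length at most 2 the notion is degenerate.
\<close>

definition induced_cycle :: "'v set \<Rightarrow> ('v \<Rightarrow> 'v \<Rightarrow> bool) \<Rightarrow> 'v list \<Rightarrow> bool" where
  "induced_cycle V adj vs \<longleftrightarrow>
     distinct vs \<and> set vs \<subseteq> V \<and>
     (\<forall>i < length vs. \<forall>j < length vs.
        adj (vs ! i) (vs ! j) \<longleftrightarrow>
          j = (i + 1) mod length vs \<or> i = (j + 1) mod length vs)"

definition chordal :: "'v set \<Rightarrow> ('v \<Rightarrow> 'v \<Rightarrow> bool) \<Rightarrow> bool" where
  "chordal V adj \<longleftrightarrow> \<not> (\<exists>vs. length vs \<ge> 4 \<and> induced_cycle V adj vs)"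


section \<open>The power graph of a group\<close>

definition power_graph_adj :: "('a, 'b) monoid_scheme \<Rightarrow> 'a \<Rightarrow> 'a \<Rightarrow> bool" where
  "power_graph_adj G a b \<longleftrightarrow>
     a \<in> carrier G \<and> b \<in> carrier G \<and> a \<noteq> b \<and>
     ((\<exists>m::nat. m > 0 \<and> a = b [^]\<^bsub>G\<^esub> m) \<or> (\<exists>n::nat. n > 0 \<and> b = a [^]\<^bsub>G\<^esub> n))"

lemma power_graph_adj_irrefl: "\<not> power_graph_adj G a a"
  by (simp add: power_graph_adj_def)

lemma power_graph_adj_sym: "power_graph_adj G a b \<Longrightarrow> power_graph_adj G b a"
  by (auto simp: power_graph_adj_def)

definition chordal_power_graph :: "('a, 'b) monoid_scheme \<Rightarrow> bool" where
  "chordal_power_graph G \<longleftrightarrow> chordal (carrier G) (power_graph_adj G)"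


section \<open>Special and projective special linear groups\<close>

definition center :: "('a, 'b) monoid_scheme \<Rightarrow> 'a set" where
  "center G = {z \<in> carrier G. \<forall>x \<in> carrier G. z \<otimes>\<^bsub>G\<^esub> x = x \<otimes>\<^bsub>G\<^esub> z}"

lemma (in group) center_normal: "center G \<lhd> G"
proof -
  have "subgroup (center G) G"
  proof (rule subgroupI)
    show "center G \<subseteq> carrier G" by (auto simp: center_def)
    show "center G \<noteq> {}" by (auto simp: center_def intro!: exI[of _ \<one>])
  next
    fix a assume a: "a \<in> center G"
    hence ac: "a \<in> carrier G" by (simp add: center_def)
    have "inv a \<otimes> x = x \<otimes> inv a" if x: "x \<in> carrier G" for x
    proof -
      have "a \<otimes> x = x \<otimes> a" using a x by (simp add: center_def)
      hence "inv a \<otimes> (x \<otimes> a) \<otimes> inv a = inv a \<otimes> (a \<otimes> x) \<otimes> inv a" by simp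
      moreover have "inv a \<otimes> (x \<otimes> a) \<otimes> inv a = inv a \<otimes> x"
        using ac x by (simp add: m_assoc)
      moreover have "inv a \<otimes> (a \<otimes> x) \<otimes> inv a = x \<otimes> inv a"
        using ac x by (simp add: m_assoc [symmetric])
      ultimately show ?thesis by simp
    qed
    thus "inv a \<in> center G" using ac by (simp add: center_def)
  next
    fix a b assume a: "a \<in> center G" and b: "b \<in> center G"
    hence ab: "a \<in> carrier G" "b \<in> carrier G" by (simp_all add: center_def)
    have "a \<otimes> b \<otimes> x = x \<otimes> (a \<otimes> b)" if x: "x \<in> carrier G" for x
    proof -
      have "a \<otimes> b \<otimes> x = a \<otimes> (b \<otimes> x)" using ab x by (simp add: m_assoc)
      also have "\<dots> = a \<otimes> (x \<otimes> b)" using b x by (simp add: center_def)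
      also have "\<dots> = a \<otimes> x \<otimes> b" using ab x by (simp add: m_assoc)
      also have "\<dots> = x \<otimes> a \<otimes> b" using a x by (simp add: center_def)
      also have "\<dots> = x \<otimes> (a \<otimes> b)" using ab x by (simp add: m_assoc)
      finally show ?thesis .
    qed
    thus "a \<otimes> b \<in> center G" using ab by (simp add: center_def)
  qed
  moreover have "x \<otimes> h \<otimes> inv x \<in> center G" if "x \<in> carrier G" "h \<in> center G" for x h
  proof -
    have hc: "h \<in> carrier G" and "x \<otimes> h = h \<otimes> x"
      using that by (simp_all add: center_def)
    hence "x \<otimes> h \<otimes> inv x = h" using that(1) by (simp add: m_assoc)
    thus ?thesis using that(2) by simp
  qed
  ultimately show ?thesis by (simp add: normal_inv_iff)
qed

text \<open>
  The degree and the field are read off from the type: \<open>SL :: ('a ^ 2 ^ 2) monoid\<close> is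
  $\mathrm{SL}(2,q)$ when \<open>'a\<close> is a field with $q$ elements.
\<close>

definition SL :: "('a::field ^ 'n ^ 'n) monoid" where
  "SL = \<lparr>carrier = {A. det A = 1}, monoid.mult = (**), one = mat 1\<rparr>"

lemma group_SL: "group (SL :: ('a::field ^ 'n ^ 'n) monoid)"
proof (rule groupI)
  fix A :: "'a ^ 'n ^ 'n" assume "A \<in> carrier SL"
  hence dA: "det A = 1" by (simp add: SL_def)
  hence "invertible A" by (simp add: invertible_det_nz)
  then obtain B where B: "B ** A = mat 1" by (auto simp: invertible_def)
  hence "det B * det A = 1" by (metis det_I det_mul)
  with dA have "det B = 1" by simp
  with B show "\<exists>B \<in> carrier SL. B \<otimes>\<^bsub>SL\<^esub> A = \<one>\<^bsub>SL\<^esub>"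
    by (auto simp: SL_def)
qed (auto simp: SL_def det_mul matrix_mul_assoc)

definition PSL :: "('a::field ^ 'n ^ 'n) set monoid" where
  "PSL = SL Mod center SL"

lemma group_PSL: "group (PSL :: ('a::field ^ 'n ^ 'n) set monoid)"
  unfolding PSL_def
  by (rule normal.factorgroup_is_group[OF group.center_normal[OF group_SL]])


section \<open>Prime powers\<close>

text \<open>Unlike \<^const>\<open>primepow\<close>, this admits the exponent 0, hence the number 1.\<close>

definition primepow_or_one :: "nat \<Rightarrow> bool" where
  "primepow_or_one n \<longleftrightarrow> (\<exists>p k. prime p \<and> n = p ^ k)"

definition prime_times_primepow :: "nat \<Rightarrow> bool" where
  "prime_times_primepow n \<longleftrightarrow> (\<exists>r m. prime r \<and> primepow_or_one m \<and> n = r * m)"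

end

theory Submission
  imports Defs "HOL-Algebra.Algebraic_Closure_Type" "HOL-Number_Theory.Residues"
begin

text \<open>
  Away from the identity, the power graph of PSL(2,q) splits into the power graphs of tori and of
  unipotent subgroups. Write an element as a matrix \<open>A\<close> of determinant 1 up to sign. If \<open>x\<close> is a
  power of \<open>y\<close> and both are non-trivial, then representing matrices generate the same
  two-dimensional commutative algebra, as a non-scalar element \<open>a + b * A\<close> generates the same
  algebra as \<open>A\<close> (\<open>torus_closed\<close>). The identity is adjacent to every vertex, so an induced cycle of
  length at least 4 avoids it and lies in the group \<open>torus A\<close> of a single algebra
  (\<open>chordal_power_graph_of_partition\<close>).

  Such a group is understood through an eigenvalue \<open>l\<close> of \<open>A\<close> in the algebraic closure. If the two
  eigenvalues \<open>l\<close> and \<open>1 / l\<close> coincide, every element is unipotent up to sign and has exponent \<open>p\<close>,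
  the characteristic (\<open>torus_unipotent\<close>); adjacency is then transitive away from the identity and there
  is no induced cycle. If they differ, sending the class of \<open>a + b * A\<close> to \<open>(a + b * l)\<^sup>2\<close> is an injective
  homomorphism into the multiplicative group of a field (\<open>torus_embedding\<close>). The Frobenius map
  sends \<open>l\<close> to \<open>l\<close> or to \<open>1 / l\<close>, so the orders in the torus divide \<open>q - 1\<close> or \<open>q + 1\<close>, halved for odd
  \<open>q\<close>, and adjacency means that one order divides the other (\<open>torus_cyclic\<close>). For an exponent of the
  form \<open>r ^ k\<close> or \<open>p * r ^ k\<close>, the divisors form at most two chains, which excludes induced cycles in
  the divisibility graph (\<open>no_induced_cycle_of_flag\<close>).

  Conversely, elements of order \<open>q - 1\<close> and \<open>q + 1\<close>, halved for odd \<open>q\<close>, exist whenever this number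
  is not 1: take the companion matrix of an eigenvalue of that order in the field with \<open>q\<^sup>2\<close> elements
  (\<open>exists_element_of_order\<close>). If such an order violates the condition, it is divisible by three
  primes or by the squares of two primes, and its divisors contain an induced hexagon or square
  (\<open>prime_times_primepow_ord_of_chordal\<close>).
\<close>

hide_const (open) Divisibility.prime

section \<open>Induced cycles in comparability graphs\<close>

text \<open>
  Reading the index modulo the length turns a cycle into a periodic sequence, so that arguments can
  walk along it without treating the closing edge separately. Length at least 4 is what makes
  vertices at distance two distinct and non-adjacent.
\<close>

lemma induced_cycle_consecutive:
  assumes "induced_cycle V adj vs" "length vs \<ge> 4"
    and x_def: "\<And>i. x i = vs ! (i mod length vs)"
  shows "x i \<in> V" "adj (x i) (x (i + 1))" "x i \<noteq> x (i + 2)" "\<not> adj (x i) (x (i + 2))"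
proof -
  let ?l = "length vs"
  have d: "distinct vs" "set vs \<subseteq> V"
    using assms(1) unfolding induced_cycle_def by blast+
  have a: "adj (vs ! i) (vs ! j) \<longleftrightarrow> j = (i + 1) mod ?l \<or> i = (j + 1) mod ?l"
    if "i < ?l" "j < ?l" for i j
    using assms(1) that unfolding induced_cycle_def by blast
  have l: "k mod ?l < ?l" for k using assms(2) by (intro mod_less_divisor) linarith
  show "x i \<in> V" unfolding x_def using d(2) l nth_mem[OF l] by blast
  show "adj (x i) (x (i + 1))" unfolding x_def using l by (simp add: a mod_simps)
  have shift: "(i + s) mod ?l \<noteq> (i + t) mod ?l" if "s < t" "t < 4" for s t
  proof
    assume "(i + s) mod ?l = (i + t) mod ?l"
    hence "?l dvd (i + t) - (i + s)"
      using that by (intro mod_eq_dvd_iff_nat[THEN iffD1]) auto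
    hence "?l dvd t - s" by simp
    thus False using that assms(2) by (auto dest: dvd_imp_le)
  qed
  have ne: "i mod ?l \<noteq> (i + 2) mod ?l" using shift[of 0 2] by simp
  show "x i \<noteq> x (i + 2)" unfolding x_def using d(1) l ne by (simp add: nth_eq_iff_index_eq)
  have n1: "(i mod ?l + 1) mod ?l \<noteq> (i + 2) mod ?l"
    and n2: "((i + 2) mod ?l + 1) mod ?l \<noteq> i mod ?l"
    using shift[of 1 2] shift[of 0 3] by (simp_all add: mod_simps numeral_eq_Suc)
  show "\<not> adj (x i) (x (i + 2))" unfolding x_def using n1 n2 l by (simp add: a)
qed

text \<open>
  Since vertices at distance two are incomparable, transitivity forces rises and falls of \<open>le\<close> to
  alternate along an induced cycle. Each of the two classes given by \<open>flag\<close> is a chain, so flags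
  also differ at distance two. Hence one of two successive minima is flagged, and so is the maximum
  between them because flags propagate upwards. The next maximum is then unflagged, which makes
  both minima around it unflagged and therefore comparable.
\<close>

lemma no_induced_cycle_of_flag:
  fixes le :: "'v \<Rightarrow> 'v \<Rightarrow> bool" and flag :: "'v \<Rightarrow> bool"
  assumes adj: "\<And>x y. x \<in> S \<Longrightarrow> y \<in> S \<Longrightarrow> adj x y \<longleftrightarrow> x \<noteq> y \<and> (le x y \<or> le y x)"
    and trans: "\<And>x y z. x \<in> S \<Longrightarrow> y \<in> S \<Longrightarrow> z \<in> S \<Longrightarrow> le x y \<Longrightarrow> le y z \<Longrightarrow> le x z"
    and up: "\<And>x y. x \<in> S \<Longrightarrow> y \<in> S \<Longrightarrow> le x y \<Longrightarrow> flag x \<Longrightarrow> flag y"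
    and chain: "\<And>x y. x \<in> S \<Longrightarrow> y \<in> S \<Longrightarrow> flag x = flag y \<Longrightarrow> le x y \<or> le y x"
    and vs: "set vs \<subseteq> S" "length vs \<ge> 4"
  shows "\<not> induced_cycle V adj vs"
proof
  assume cyc: "induced_cycle V adj vs"
  obtain x where x_def: "\<And>i. x i = vs ! (i mod length vs)" by fast
  have S: "x i \<in> S" for i
  proof -
    have "i mod length vs < length vs" using vs(2) by (intro mod_less_divisor) linarith
    thus ?thesis unfolding x_def using vs(1) nth_mem by blast
  qed
  note path = induced_cycle_consecutive[OF cyc vs(2) x_def]
  have step: "le (x i) (x (i + 1)) \<or> le (x (i + 1)) (x i)" for i
    using path(2)[of i] adj[OF S S] by blast
  have incomp: "\<not> le (x i) (x (i + 2))" "\<not> le (x (i + 2)) (x i)" for i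
    using path(3,4)[of i] adj[OF S S] by blast+
  \<comment> \<open>rises and falls alternate along the cycle\<close>
  have down: "le (x (i + 2)) (x (i + 1))" if "le (x i) (x (i + 1))" for i
    using trans[OF S S S that, of "i + 2"] incomp(1)[of i] step[of "i + 1"] by (auto simp: numeral_eq_Suc)
  have rise: "le (x (i + 1)) (x (i + 2))" if "le (x (i + 1)) (x i)" for i
    using trans[OF S S S _ that, of "i + 2"] incomp(2)[of i] step[of "i + 1"] by (auto simp: numeral_eq_Suc)
  \<comment> \<open>an index \<open>i\<close> at which \<open>x i\<close> is a minimum and \<open>x (i + 1)\<close> a maximum\<close>
  obtain i where i: "le (x i) (x (i + 1))"
    using step[of 0] rise[of 0] by (cases "le (x 0) (x 1)") (auto simp: numeral_eq_Suc)
  have i2: "le (x (i + 2)) (x (i + 1))" by (rule down[OF i])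
  have i3: "le (x (i + 2)) (x (i + 3))"
    using rise[of "i + 1"] i2 by (simp add: numeral_eq_Suc)
  have f: "flag (x i) \<noteq> flag (x (i + 2))"
    using chain[OF S S, of i "i + 2"] incomp[of i] by blast
  have g: "flag (x (i + 1)) \<noteq> flag (x (i + 3))"
    using chain[OF S S, of "i + 1" "i + 3"] incomp[of "i + 1"] by (simp add: numeral_eq_Suc) blast
  \<comment> \<open>one of the minima \<open>x i\<close>, \<open>x (i + 2)\<close> is flagged, hence the maximum between them\<close>
  have "flag (x (i + 1))" using f up[OF S S i] up[OF S S i2] by blast
  moreover have "flag (x (i + 2)) \<Longrightarrow> flag (x (i + 3))" by (rule up[OF S S i3])
  ultimately have nf: "\<not> flag (x (i + 2))" "\<not> flag (x (i + 3))" using f g by blast+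
  have "le (x (i + 4)) (x (i + 3))" using down[of "i + 2"] i3 by (simp add: numeral_eq_Suc)
  hence "\<not> flag (x (i + 4))" using up[OF S S] nf(2) by blast
  thus False using chain[OF S S, of "i + 2" "i + 4"] incomp[of "i + 2"] nf(1)
    by (simp add: numeral_eq_Suc)
qed

section \<open>Divisors of the exponent\<close>

text \<open>
  These two shapes yield an induced hexagon and an induced square of divisors, respectively. They
  are found by splitting off the full powers of two primes: either a third prime remains, or both
  exponents are at least 2.
\<close>

lemma not_prime_times_primepow_cases:
  assumes "n > 0" "\<not> primepow_or_one n" "\<not> prime_times_primepow n"
  obtains (three) p q r where "prime p" "prime q" "prime r" "p \<noteq> q" "p \<noteq> r" "q \<noteq> r" "p * q * r dvd n"
  | (two) p q where "prime p" "prime q" "p \<noteq> q" "p ^ 2 * q ^ 2 dvd n"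
proof -
  have "n \<noteq> 1" using assms(2) unfolding primepow_or_one_def by (metis power_0 two_is_prime_nat)
  then obtain p where p: "prime p" "p dvd n" using prime_factor_nat by blast
  define a where "a = multiplicity p n"
  obtain m where m: "n = p ^ a * m" "\<not> p dvd m"
    unfolding a_def using p assms(1) by (metis multiplicity_decompose' not_prime_unit not_gr0)
  have a: "a > 0" using p m by (cases a) auto
  have "m \<noteq> 1" using assms(2) p m unfolding primepow_or_one_def by (metis mult.right_neutral)
  then obtain q where q: "prime q" "q dvd m" using prime_factor_nat by blast
  define b where "b = multiplicity q m"
  have "m > 0" using m assms(1) by (cases m) auto
  then obtain k where k: "m = q ^ b * k" "\<not> q dvd k"
    unfolding b_def using q by (metis multiplicity_decompose' not_prime_unit not_gr0)
  have b: "b > 0" using q k by (cases b) auto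
  have pq: "p \<noteq> q" using m q by auto
  show thesis
  proof (cases "k = 1")
    case False
    then obtain r where r: "prime r" "r dvd k" using prime_factor_nat by blast
    have "p * q * r dvd p ^ a * (q ^ b * k)"
      using a b r by (simp add: mult.assoc) (intro mult_dvd_mono; simp add: dvd_power)
    moreover have "p \<noteq> r" using m k r by auto
    moreover have "q \<noteq> r" using k r by auto
    ultimately show thesis using three p q r pq m k by metis
  next
    case True
    hence n: "n = p ^ a * q ^ b" using m k by simp
    have "a \<noteq> 1"
      using assms(3) n p q unfolding prime_times_primepow_def primepow_or_one_def
      by (metis power_one_right)
    moreover have "b \<noteq> 1"
      using assms(3) n p q unfolding prime_times_primepow_def primepow_or_one_def
      by (metis power_one_right mult.commute)
    ultimately have "2 \<le> a" "2 \<le> b" using a b by linarith+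
    hence "p ^ 2 * q ^ 2 dvd n" unfolding n by (intro mult_dvd_mono le_imp_power_dvd)
    thus thesis using two p q pq by blast
  qed
qed

lemma divisors_comparable_of_primepow:
  fixes p :: nat
  assumes "prime p" "u dvd p ^ k" "v dvd p ^ k"
  shows "u dvd v \<or> v dvd u"
proof -
  obtain i j where "u = p ^ i" "v = p ^ j"
    using assms by (auto simp: divides_primepow_nat)
  thus ?thesis using le_imp_power_dvd[of i j p] le_imp_power_dvd[of j i p] nat_le_linear by blast
qed

text \<open>
  The divisors of \<open>p * r ^ k\<close> form two chains, told apart by divisibility by \<open>p\<close>; this
  divisibility is the flag used for the lemma on comparability graphs.
\<close>

lemma divisors_comparable_of_prime_times_primepow:
  fixes p r :: nat
  assumes "prime p" "prime r" "u dvd p * r ^ k" "v dvd p * r ^ k" "p dvd u \<longleftrightarrow> p dvd v"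
  shows "u dvd v \<or> v dvd u"
proof (cases "p dvd u")
  case True
  then obtain u' v' where "u = p * u'" "v = p * v'" using assms(5) by (auto elim!: dvdE)
  moreover have "p > 0" using assms(1) prime_gt_0_nat by blast
  ultimately show ?thesis
    using assms(3,4) divisors_comparable_of_primepow[OF assms(2), of u' k v'] by simp
next
  case False
  hence "coprime u p" "coprime v p"
    using assms(1,5) prime_imp_coprime_nat coprime_commute by blast+
  thus ?thesis
    using assms(3,4) divisors_comparable_of_primepow[OF assms(2), of u k v]
    by (simp add: coprime_dvd_mult_right_iff)
qed

section \<open>Power graphs of groups\<close>

context group
begin

lemma power_imp_ord_dvd:
  assumes "y \<in> carrier G" "x = y [^] (m::nat)"
  shows "ord x dvd ord y"
proof -
  have "x [^] ord y = (y [^] ord y) [^] m"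
    using assms by (simp add: nat_pow_pow mult.commute del: pow_ord_eq_1)
  thus ?thesis using assms by (simp flip: pow_eq_id)
qed

text \<open>
  In the cyclic group generated by \<open>g\<close>, pick the element \<open>g [^] (n div u)\<close> of order \<open>u\<close> for each
  divisor \<open>u\<close> of \<open>n\<close>. Two such elements are adjacent precisely when their orders are comparable
  under divisibility, so a cycle in the divisor graph lifts to the power graph of the whole group.
\<close>

lemma induced_cycle_of_divisors:
  assumes g: "g \<in> carrier G" "ord g = n" "n > 0"
    and us: "distinct us" "\<And>u. u \<in> set us \<Longrightarrow> u dvd n"
    and cyc: "\<And>i j. i < length us \<Longrightarrow> j < length us \<Longrightarrow>
      (us ! i \<noteq> us ! j \<and> (us ! i dvd us ! j \<or> us ! j dvd us ! i)) \<longleftrightarrow>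
        j = (i + 1) mod length us \<or> i = (j + 1) mod length us"
  shows "induced_cycle (carrier G) (power_graph_adj G) (map (\<lambda>u. g [^] (n div u)) us)"
proof -
  let ?e = "\<lambda>u. g [^] (n div u)"
  have e: "?e u \<in> carrier G" for u using g by simp
  have ord_e: "ord (?e u) = u" if u: "u dvd n" for u
  proof -
    obtain w where w: "n = u * w" using u unfolding dvd_def by blast
    have "u > 0" "w > 0" using w g(3) by auto
    moreover have "ord (g [^] w) = ord g div w" using g w \<open>w > 0\<close> by (intro ord_pow) auto
    ultimately show ?thesis using w g by simp
  qed
  have pow: "\<exists>m>0. ?e u = ?e v [^] (m::nat)" if uv: "u dvd v" "v dvd n" for u v
  proof -
    obtain c d where cd: "v = u * c" "n = v * d" using uv unfolding dvd_def by blast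
    have pos: "u > 0" "c > 0" "d > 0" using cd g(3) by auto
    have nu: "n div u = n div v * c"
      using cd pos by (simp add: mult.assoc)
    have "?e u = ?e v [^] c" unfolding nu using g by (simp add: nat_pow_pow)
    thus ?thesis using pos by blast
  qed
  have adj: "power_graph_adj G (?e u) (?e v) \<longleftrightarrow> u \<noteq> v \<and> (u dvd v \<or> v dvd u)"
    if uv: "u dvd n" "v dvd n" for u v
  proof
    assume "power_graph_adj G (?e u) (?e v)"
    hence "?e u \<noteq> ?e v" and c: "(\<exists>m::nat. ?e u = ?e v [^] m) \<or> (\<exists>m::nat. ?e v = ?e u [^] m)"
      by (auto simp: power_graph_adj_def)
    moreover from c have "u dvd v \<or> v dvd u"
      using power_imp_ord_dvd[OF e] ord_e uv by metis
    ultimately show "u \<noteq> v \<and> (u dvd v \<or> v dvd u)" by blast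
  next
    assume *: "u \<noteq> v \<and> (u dvd v \<or> v dvd u)"
    hence "?e u \<noteq> ?e v" using ord_e[OF uv(1)] ord_e[OF uv(2)] by metis
    thus "power_graph_adj G (?e u) (?e v)"
      using * pow uv e unfolding power_graph_adj_def by blast
  qed
  have "inj_on ?e (set us)"
  proof (rule inj_onI)
    fix u v assume uv: "u \<in> set us" "v \<in> set us" and eq: "?e u = ?e v"
    have "u = ord (?e u)" using ord_e us(2) uv(1) by simp
    also have "\<dots> = v" unfolding eq using ord_e us(2) uv(2) by simp
    finally show "u = v" .
  qed
  hence "distinct (map ?e us)" using us(1) by (simp add: distinct_map)
  thus ?thesis
    unfolding induced_cycle_def using e adj[OF us(2) us(2)] cyc by (simp add: image_subset_iff)
qed

text \<open>
  With three primes the hexagon \<open>p, p * q, q, q * r, r, p * r\<close> has no chord; with two squared primes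
  the square \<open>p, p\<^sup>2 * q, q, p * q\<^sup>2\<close> has none.
\<close>

lemma prime_times_primepow_ord_of_chordal:
  assumes "chordal_power_graph G" "g \<in> carrier G" "ord g > 0"
  shows "primepow_or_one (ord g) \<or> prime_times_primepow (ord g)"
proof (rule ccontr)
  assume "\<not> ?thesis"
  hence bad: "\<not> primepow_or_one (ord g)" "\<not> prime_times_primepow (ord g)" by auto
  have no: "\<not> induced_cycle (carrier G) (power_graph_adj G) vs" if "length vs \<ge> 4" for vs
    using assms(1) that by (auto simp: chordal_power_graph_def chordal_def)
  from assms(3) bad show False
  proof (cases rule: not_prime_times_primepow_cases)
    case (three p q r)
    let ?us = "[p, p * q, q, q * r, r, p * r]"
    have gt: "p > 1" "q > 1" "r > 1" using three prime_gt_1_nat by blast+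
    have nd: "\<not> p dvd q" "\<not> q dvd p" "\<not> p dvd r" "\<not> r dvd p" "\<not> q dvd r" "\<not> r dvd q"
      using three by (auto dest: primes_dvd_imp_eq)
    have "induced_cycle (carrier G) (power_graph_adj G) (map (\<lambda>u. g [^] (ord g div u)) ?us)"
    proof (rule induced_cycle_of_divisors[OF assms(2) refl assms(3)])
      show "distinct ?us" using gt nd three by auto
      have "u dvd p * q * r" if "u \<in> set ?us" for u
        using that by (auto simp: mult.assoc)
      thus "u dvd ord g" if "u \<in> set ?us" for u
        using that dvd_trans[OF _ three(7)] by blast
      have nd': "\<not> p * q dvd q * r" "\<not> p * q dvd p * r" "\<not> q * r dvd p * q"
        "\<not> q * r dvd p * r" "\<not> p * r dvd p * q" "\<not> p * r dvd q * r"
        using nd gt by (simp_all add: mult.commute)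
      fix i j assume "i < length ?us" "j < length ?us"
      hence "i \<in> {0,1,2,3,4,5}" "j \<in> {0,1,2,3,4,5}" by auto
      thus "(?us ! i \<noteq> ?us ! j \<and> (?us ! i dvd ?us ! j \<or> ?us ! j dvd ?us ! i)) \<longleftrightarrow>
        j = (i + 1) mod length ?us \<or> i = (j + 1) mod length ?us"
        using gt nd nd' three(1-3)
        by (elim insertE emptyE; simp add: prime_dvd_mult_iff; force dest: dvd_mult_left dvd_mult_right)
    qed
    thus False using no by simp
  next
    case (two p q)
    let ?us = "[p, p * p * q, q, p * q * q]"
    have gt: "p > 1" "q > 1" using two prime_gt_1_nat by blast+
    have nd: "\<not> p dvd q" "\<not> q dvd p" using two by (auto dest: primes_dvd_imp_eq)
    have "induced_cycle (carrier G) (power_graph_adj G) (map (\<lambda>u. g [^] (ord g div u)) ?us)"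
    proof (rule induced_cycle_of_divisors[OF assms(2) refl assms(3)])
      show "distinct ?us" using gt nd by auto
      have "p * p * q * q dvd ord g" using two(4) by (simp add: power2_eq_square mult.assoc)
      moreover have "u dvd p * p * q * q" if "u \<in> set ?us" for u
        using that by (auto simp: mult.assoc mult.left_commute)
      ultimately show "u dvd ord g" if "u \<in> set ?us" for u
        using that dvd_trans[of u "p * p * q * q" "ord g"] by blast
      have nd': "\<not> p * p * q dvd p * q * q" "\<not> p * q * q dvd p * p * q"
        using nd gt by (simp_all add: mult.assoc mult.left_commute)
      fix i j assume "i < length ?us" "j < length ?us"
      hence "i \<in> {0,1,2,3}" "j \<in> {0,1,2,3}" by auto
      thus "(?us ! i \<noteq> ?us ! j \<and> (?us ! i dvd ?us ! j \<or> ?us ! j dvd ?us ! i)) \<longleftrightarrow>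
        j = (i + 1) mod length ?us \<or> i = (j + 1) mod length ?us"
        using gt nd nd' two(1-2)
        by (elim insertE emptyE; simp add: prime_dvd_mult_iff; force dest: dvd_mult_left dvd_mult_right)
    qed
    thus False using no by simp
  qed
qed

text \<open>
  Adjacency asks for positive exponents; adding the order of \<open>y\<close> makes any exponent positive.
\<close>

lemma pow_pos_exponent:
  assumes "finite (carrier G)" "y \<in> carrier G" "x = y [^] (m::nat)"
  shows "\<exists>m>0. x = y [^] (m::nat)"
proof -
  have "x = y [^] (m + ord y)"
    using assms(2,3) by (metis nat_pow_mult pow_ord_eq_1 r_one nat_pow_closed)
  thus ?thesis using ord_ge_1[OF assms(1,2)] by (intro exI[of _ "m + ord y"]) simp
qed

text \<open>
  If \<open>b [^] p = \<one>\<close>, every power of \<open>b\<close> other than \<open>\<one>\<close> generates the same subgroup as \<open>b\<close>.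
  Adjacency is then symmetric generation, hence transitive, and two consecutive edges give a chord.
\<close>

lemma not_induced_cycle_of_prime_exponent:
  fixes p :: nat
  assumes fin: "finite (carrier G)" and "prime p"
    and vs: "set vs \<subseteq> carrier G - {\<one>}" "\<And>x. x \<in> set vs \<Longrightarrow> x [^] p = \<one>" "length vs \<ge> 4"
  shows "\<not> induced_cycle (carrier G) (power_graph_adj G) vs"
proof
  assume cyc: "induced_cycle (carrier G) (power_graph_adj G) vs"
  obtain x where x_def: "\<And>i. x i = vs ! (i mod length vs)" by fast
  have "x i \<in> set vs" for i
  proof -
    have "i mod length vs < length vs" using vs(3) by (intro mod_less_divisor) linarith
    thus ?thesis unfolding x_def by simp
  qed
  hence x: "x i \<in> carrier G" "x i \<noteq> \<one>" "x i [^] p = \<one>" for i using vs by auto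
  note path = induced_cycle_consecutive[OF cyc vs(3) x_def]
  have sym: "\<exists>m. b = a [^] (m::nat)"
    if a: "a \<noteq> \<one>" and b: "b \<in> carrier G" "b [^] p = \<one>" and ab: "a = b [^] (m::nat)" for a b m
  proof -
    have "\<not> p dvd m"
    proof
      assume "p dvd m"
      hence "a = (b [^] p) [^] (m div p)"
        unfolding ab using b(1) by (metis dvd_mult_div_cancel nat_pow_pow)
      thus False using a b by simp
    qed
    hence "coprime m p" using \<open>prime p\<close> prime_imp_coprime_nat coprime_commute by blast
    moreover have "p > 1" using \<open>prime p\<close> prime_gt_1_nat by blast
    ultimately obtain k where "cong (m * k) 1 p"
      using cong_solve_coprime_nat[of m p] by auto
    hence "m * k mod p = 1" using \<open>p > 1\<close> by (simp add: cong_def)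
    then obtain t where t: "m * k = p * t + 1" using mult_div_mod_eq[of p "m * k"] by metis
    have "a [^] k = b [^] (p * t + 1)" unfolding ab using b t by (simp add: nat_pow_pow)
    also have "\<dots> = (b [^] p) [^] t \<otimes> b"
      using b(1) by (metis nat_pow_mult nat_pow_pow nat_pow_eone)
    also have "\<dots> = b" using b by simp
    finally show ?thesis by metis
  qed
  have edge: "\<exists>m. x i = x j [^] (m::nat)" if "power_graph_adj G (x i) (x j)" for i j
    using that sym x unfolding power_graph_adj_def by metis
  obtain k l where kl: "x 0 = x 1 [^] (k::nat)" "x 1 = x 2 [^] (l::nat)"
    using edge path(2)[of 0] path(2)[of 1] by (metis add_0 one_add_one)
  hence "x 0 = x 2 [^] (l * k)" using x(1) by (simp add: nat_pow_pow)
  then obtain m where "m > 0" "x 0 = x 2 [^] (m::nat)" using pow_pos_exponent fin x(1) by blast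
  hence "power_graph_adj G (x 0) (x 2)"
    using path(3)[of 0, unfolded add_0] x(1) by (auto simp: power_graph_adj_def)
  thus False using path(4)[of 0, unfolded add_0] by blast
qed

text \<open>
  The last assumption says that the vertices behave like elements of one cyclic group: adjacency is
  comparability of orders, and the orders divide a number whose divisors form at most two chains.
\<close>

lemma not_induced_cycle_of_cyclic:
  assumes fin: "finite (carrier G)" and n: "primepow_or_one n \<or> prime_times_primepow n"
    and vs: "set vs \<subseteq> carrier G" "\<And>x. x \<in> set vs \<Longrightarrow> x [^] n = \<one>" "length vs \<ge> 4"
    and pow: "\<And>x y. x \<in> set vs \<Longrightarrow> y \<in> set vs \<Longrightarrow> ord x dvd ord y \<Longrightarrow> \<exists>m. x = y [^] (m::nat)"
  shows "\<not> induced_cycle (carrier G) (power_graph_adj G) vs"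
proof -
  have ordn: "ord x dvd n" if "x \<in> set vs" for x
    using vs that by (simp flip: pow_eq_id add: subset_iff)
  have "\<exists>flag. (\<forall>x\<in>set vs. \<forall>y\<in>set vs. ord x dvd ord y \<longrightarrow> flag x \<longrightarrow> flag y) \<and>
      (\<forall>x\<in>set vs. \<forall>y\<in>set vs. flag x = flag y \<longrightarrow> ord x dvd ord y \<or> ord y dvd ord x)"
  proof -
    consider (primepow) p k where "prime p" "n = p ^ k"
      | (times) p r k where "prime p" "prime r" "n = p * r ^ k"
      using n unfolding primepow_or_one_def prime_times_primepow_def by blast
    thus ?thesis
    proof cases
      case primepow
      have "ord x dvd ord y \<or> ord y dvd ord x" if "x \<in> set vs" "y \<in> set vs" for x y
        using divisors_comparable_of_primepow[of p "ord x" k "ord y"] primepow ordn that by simp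
      thus ?thesis by (intro exI[of _ "\<lambda>_. False"]) simp
    next
      case times
      have "\<And>x y. ord x dvd ord y \<Longrightarrow> p dvd ord x \<Longrightarrow> p dvd ord y"
        by (rule dvd_trans)
      moreover have "ord x dvd ord y \<or> ord y dvd ord x"
        if "x \<in> set vs" "y \<in> set vs" "p dvd ord x \<longleftrightarrow> p dvd ord y" for x y
        using divisors_comparable_of_prime_times_primepow[of p r "ord x" k "ord y"] times ordn that by simp
      ultimately show ?thesis by (intro exI[of _ "\<lambda>x. p dvd ord x"]) simp
    qed
  qed
  then obtain flag where
    FL: "(\<forall>x\<in>set vs. \<forall>y\<in>set vs. ord x dvd ord y \<longrightarrow> flag x \<longrightarrow> flag y) \<and>
      (\<forall>x\<in>set vs. \<forall>y\<in>set vs. flag x = flag y \<longrightarrow> ord x dvd ord y \<or> ord y dvd ord x)" ..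
  have up: "flag y" if "x \<in> set vs" "y \<in> set vs" "ord x dvd ord y" "flag x" for x y
    using FL that by simp
  have chain: "ord x dvd ord y \<or> ord y dvd ord x"
    if "x \<in> set vs" "y \<in> set vs" "flag x = flag y" for x y
    using FL that by simp
  have adj: "power_graph_adj G x y \<longleftrightarrow> x \<noteq> y \<and> (ord x dvd ord y \<or> ord y dvd ord x)"
    if "x \<in> set vs" "y \<in> set vs" for x y
  proof -
    have c: "x \<in> carrier G" "y \<in> carrier G" using that vs by auto
    have "(\<exists>m::nat. m > 0 \<and> a = b [^] m) \<longleftrightarrow> ord a dvd ord b"
      if "a \<in> set vs" "b \<in> set vs" for a b
    proof -
      have "b \<in> carrier G" using that vs by auto
      thus ?thesis
        using pow[OF that] pow_pos_exponent[OF fin, of b a] power_imp_ord_dvd[of b a] by blast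
    qed
    thus ?thesis unfolding power_graph_adj_def using c that by simp
  qed
  show ?thesis
  proof (rule no_induced_cycle_of_flag[where S = "set vs" and flag = flag and le = "\<lambda>x y. ord x dvd ord y"])
    show "ord x dvd ord z" if "ord x dvd ord y" "ord y dvd ord z" for x y z
      using that by (rule dvd_trans)
  qed (use adj up chain vs(3) in simp_all)
qed

text \<open>
  An induced cycle of length at least 4 avoids \<open>\<one>\<close>, which is adjacent to everything. It therefore
  stays in one member of a family of subsets that is closed under adjacency away from \<open>\<one>\<close>, and it
  suffices to exclude cycles inside each member.
\<close>

theorem chordal_power_graph_of_partition:
  assumes fin: "finite (carrier G)"
    and cover: "\<And>x. x \<in> carrier G \<Longrightarrow> x \<noteq> \<one> \<Longrightarrow> \<exists>K\<in>F. x \<in> K"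
    and closed: "\<And>K x y. K \<in> F \<Longrightarrow> x \<in> K \<Longrightarrow> x \<noteq> \<one> \<Longrightarrow> y \<noteq> \<one> \<Longrightarrow> power_graph_adj G x y \<Longrightarrow> y \<in> K"
    and part: "\<And>K. K \<in> F \<Longrightarrow> (\<exists>p::nat. prime p \<and> (\<forall>x\<in>K. x [^] p = \<one>)) \<or>
      (\<exists>n. (primepow_or_one n \<or> prime_times_primepow n) \<and> (\<forall>x\<in>K. x [^] n = \<one>) \<and>
        (\<forall>x\<in>K. \<forall>y\<in>K. ord x dvd ord y \<longrightarrow> (\<exists>m::nat. x = y [^] m)))"
  shows "chordal_power_graph G"
proof -
  have False if cyc: "induced_cycle (carrier G) (power_graph_adj G) vs" and len: "length vs \<ge> 4" for vs
  proof -
    obtain x where x_def: "\<And>i. x i = vs ! (i mod length vs)" by fast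
    note path = induced_cycle_consecutive[OF cyc len x_def]
    have one: "power_graph_adj G \<one> y" if "y \<in> carrier G" "y \<noteq> \<one>" for y
    proof -
      have "\<exists>m>0. \<one> = y [^] (m::nat)" using pow_pos_exponent[OF fin that(1), of \<one> 0] by simp
      thus ?thesis using that by (auto simp: power_graph_adj_def)
    qed
    have x1: "x i \<noteq> \<one>" for i using path(1,3,4) one by metis
    obtain K where K: "K \<in> F" "x 0 \<in> K" using cover path(1) x1 by blast
    have xK: "x i \<in> K" for i
    proof (induction i)
      case (Suc i)
      thus ?case using closed[OF K(1) _ x1 x1] path(2)[of i] by simp
    qed (use K in simp)
    have vs: "v \<in> K \<and> v \<in> carrier G \<and> v \<noteq> \<one>" if v: "v \<in> set vs" for v
    proof -
      obtain i where "i < length vs" "v = vs ! i" using v by (metis in_set_conv_nth)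
      hence "v = x i" by (simp add: x_def)
      thus ?thesis using xK x1 path(1) by simp
    qed
    from part[OF K(1)] show False
    proof (elim disjE exE conjE)
      fix p :: nat assume "prime p" "\<forall>x\<in>K. x [^] p = \<one>"
      thus False using not_induced_cycle_of_prime_exponent[OF fin _ _ _ len] vs cyc by blast
    next
      fix n assume "primepow_or_one n" "\<forall>x\<in>K. x [^] n = \<one>"
        "\<forall>x\<in>K. \<forall>y\<in>K. ord x dvd ord y \<longrightarrow> (\<exists>m::nat. x = y [^] m)"
      thus False using not_induced_cycle_of_cyclic[OF fin _ _ _ len] vs cyc by blast
    next
      fix n assume "prime_times_primepow n" "\<forall>x\<in>K. x [^] n = \<one>"
        "\<forall>x\<in>K. \<forall>y\<in>K. ord x dvd ord y \<longrightarrow> (\<exists>m::nat. x = y [^] m)"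
      thus False using not_induced_cycle_of_cyclic[OF fin _ _ _ len] vs cyc by blast
    qed
  qed
  thus ?thesis unfolding chordal_power_graph_def chordal_def by blast
qed

end

section \<open>Finite fields inside their algebraic closure\<close>

text \<open>
  Multiplication by \<open>x \<noteq> 0\<close> permutes the non-zero elements, so comparing products gives
  \<open>x ^ (CARD('a) - 1) = 1\<close>.
\<close>

lemma power_card_eq_self:
  fixes x :: "'a::{field,finite}"
  shows "x ^ CARD('a) = x"
proof (cases "x = 0")
  case False
  have "(\<Prod>y\<in>UNIV - {0::'a}. y) = (\<Prod>y\<in>UNIV - {0}. x * y)"
    by (rule prod.reindex_bij_witness[of _ "\<lambda>y. x * y" "\<lambda>y. y / x"]) (use False in auto)
  also have "\<dots> = x ^ (CARD('a) - 1) * (\<Prod>y\<in>UNIV - {0}. y)"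
    by (simp add: prod.distrib)
  finally have "x ^ (CARD('a) - 1) = 1" by simp
  hence "x * x ^ (CARD('a) - 1) = x" by simp
  thus ?thesis by (simp add: power_eq_if)
qed simp

lemma CARD_eq_CHAR_power:
  assumes "primepow CARD('a::{field,finite})"
  obtains k where "prime CHAR('a)" "k > 0" "CARD('a) = CHAR('a) ^ k"
proof -
  have pr: "prime CHAR('a)"
    using prime_CHAR_semidom[where ?'a = 'a] finite_imp_CHAR_pos[where ?'a = 'a] by simp
  obtain p k where pk: "prime p" "k > 0" "CARD('a) = p ^ k"
    using assms by (auto simp: primepow_def)
  have "CHAR('a) dvd p ^ k" using CHAR_dvd_CARD[where ?'a = 'a] pk by simp
  hence "CHAR('a) = p" using pr pk prime_dvd_power primes_dvd_imp_eq by blast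
  thus thesis using that pr pk by blast
qed

text \<open>
  A prime power number of elements is a power of the characteristic, so this is an iterate of the
  binomial theorem in prime characteristic.
\<close>

lemma alg_closure_frobenius_add:
  fixes x y :: "'a::{field,finite} alg_closure"
  assumes "primepow CARD('a)" "m = CARD('a) ^ n"
  shows "(x + y) ^ m = x ^ m + y ^ m"
proof -
  obtain k where k: "prime CHAR('a)" "CARD('a) = CHAR('a) ^ k"
    using CARD_eq_CHAR_power[OF assms(1)] by blast
  show ?thesis
    by (rule freshmans_dream'[where n = "k * n"]) (use k assms in \<open>simp_all add: power_mult\<close>)
qed

text \<open>
  The polynomial \<open>X ^ q - X\<close> has at most \<open>q\<close> roots, and the \<open>q\<close> elements of the field are roots.
\<close>

lemma alg_closure_fixed_iff:
  fixes x :: "'a::{field,finite} alg_closure"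
  shows "x ^ CARD('a) = x \<longleftrightarrow> x \<in> range to_ac"
proof -
  let ?q = "CARD('a)" and ?S = "{x :: 'a alg_closure. x ^ CARD('a) = x}"
  define p :: "'a alg_closure poly" where "p = monom 1 ?q + [:0, - 1:]"
  have "card {0, 1 :: 'a} \<le> ?q" by (rule card_mono) simp_all
  hence q: "?q > 1" by simp
  have S: "{x. poly p x = 0} = ?S" by (simp add: p_def poly_monom)
  have deg: "degree p = ?q"
    unfolding p_def using q by (simp add: degree_add_eq_left degree_monom_eq)
  hence "p \<noteq> 0" using q by auto
  hence "finite ?S" "card ?S \<le> ?q"
    using poly_roots_finite card_poly_roots_bound deg S by metis+
  moreover have "range (to_ac :: 'a \<Rightarrow> _) \<subseteq> ?S"
    by (auto simp: power_card_eq_self simp flip: to_ac_power)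
  moreover have "card (range (to_ac :: 'a \<Rightarrow> _)) = ?q"
    by (rule card_image[OF inj_to_ac])
  ultimately have "range (to_ac :: 'a \<Rightarrow> _) = ?S"
    by (metis card_subset_eq card_mono le_antisym)
  thus ?thesis by blast
qed

text \<open>
  The polynomial splits into \<open>degree p\<close> linear factors. No factor occurs twice, as its root would
  also be a root of the derivative.
\<close>

lemma card_roots_of_separable:
  fixes p :: "'a::alg_closed_field poly"
  assumes p0: "p \<noteq> 0" and sep: "\<And>x. poly p x = 0 \<Longrightarrow> poly (pderiv p) x \<noteq> 0"
  shows "card {x. poly p x = 0} = degree p"
proof -
  obtain A where A: "size A = degree p" "p = smult (lead_coeff p) (\<Prod>x\<in>#A. [:- x, 1:])"
    using alg_closed_imp_factorization[OF p0] by blast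
  have nz: "(\<Prod>x\<in>#B. [:- x, 1:]) \<noteq> 0" for B :: "'a multiset"
    by (auto simp: prod_mset_zero_iff)
  have "proots p = proots (\<Prod>x\<in>#A. [:- x, 1:])"
    by (subst A(2)) (use p0 in simp)
  also have "\<dots> = A"
    by (induction A) (use nz in \<open>simp_all add: proots_mult del: mult_pCons_left\<close>)
  finally have "proots p = A" .
  moreover have "count (proots p) x \<le> 1" for x
  proof (rule ccontr)
    assume "\<not> ?thesis"
    hence "[:- x, 1:] ^ 2 dvd p" using p0 by (simp add: order_divides)
    moreover obtain f where f: "f = [:- x, 1:]" by blast
    ultimately have "f ^ 2 dvd p" by simp
    then obtain g where g: "p = f * (f * g)"
      unfolding dvd_def power2_eq_square mult.assoc by blast
    have "poly f x = 0" by (simp add: f)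
    hence "poly p x = 0" "poly (pderiv p) x = 0" unfolding g by (simp_all add: pderiv_mult)
    thus False using sep by blast
  qed
  ultimately have "count A x \<le> 1" for x by simp
  moreover have "count A x \<ge> 1" if "x \<in># A" for x using that by (simp add: Suc_leI)
  ultimately have "count A x = (if x \<in># A then 1 else 0)" for x
    by (simp add: le_antisym not_in_iff)
  hence "A = mset_set (set_mset A)"
    by (intro multiset_eqI) (simp add: count_mset_set')
  hence "size A = card (set_mset A)" by (metis size_mset_set)
  thus ?thesis using A p0 \<open>proots p = A\<close> by (metis set_count_proots)
qed

lemma alg_closure_quadratic_root:
  fixes t :: "'a::field alg_closure"
  obtains l where "l ^ 2 - t * l + 1 = 0"
proof -
  have "\<exists>l. poly [:1, - t, 1:] l = 0" by (rule alg_closed_imp_poly_has_root) simp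
  thus thesis using that by (auto simp: algebra_simps power2_eq_square)
qed

text \<open>
  The roots of \<open>X ^ q\<^sup>2 - X\<close> form a field with \<open>q\<^sup>2\<close> elements, since the polynomial is separable and
  raising to the power \<open>q\<^sup>2\<close> is additive. Its multiplicative group is cyclic of order \<open>q\<^sup>2 - 1\<close>, and
  a suitable power of a generator has any prescribed order dividing \<open>q\<^sup>2 - 1\<close>. Both \<open>q - 1\<close> and
  \<open>q + 1\<close> are such orders, which lets the split and the non-split torus be treated alike.
\<close>

lemma alg_closure_root_of_unity:
  assumes pp: "primepow CARD('a::{field,finite})"
    and N: "N dvd CARD('a) ^ 2 - 1"
  obtains l :: "'a::{field,finite} alg_closure" where "\<And>k. l ^ k = 1 \<longleftrightarrow> N dvd k"
proof -
  let ?Q = "CARD('a) ^ 2"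
  have "CARD('a) > 1" using primepow_gt_Suc_0[OF pp] by simp
  hence Q: "?Q > 1" by (rule one_less_power) simp
  define p :: "'a alg_closure poly" where "p = monom 1 ?Q + [:0, - 1:]"
  define S where "S = {x :: 'a alg_closure. x ^ ?Q = x}"
  have S: "{x. poly p x = 0} = S" by (simp add: p_def poly_monom S_def)
  have deg: "degree p = ?Q"
    unfolding p_def using Q by (simp add: degree_add_eq_left degree_monom_eq)
  obtain k where k: "k > 0" "CARD('a) = CHAR('a) ^ k" using CARD_eq_CHAR_power[OF pp] by blast
  have "of_nat ?Q = (0 :: 'a alg_closure)" using k by (simp add: of_nat_eq_0_iff_char_dvd)
  hence p': "pderiv p = - 1" unfolding p_def by (simp add: pderiv_add pderiv_monom pderiv_pCons one_pCons)
  have "p \<noteq> 0" using deg Q by auto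
  hence card: "card S = ?Q" using card_roots_of_separable[of p] deg S p' by simp
  hence fin: "finite S" using Q by (metis card.infinite not_one_less_zero)
  note frob = alg_closure_frobenius_add[OF pp refl, of _ _ 2]
  define R :: "'a alg_closure ring" where
    "R = \<lparr>carrier = S, monoid.mult = (\<lambda>x y. x * y), one = 1, ring.zero = 0, add = (+)\<rparr>"
  have cl: "x + y \<in> S" "x * y \<in> S" if "x \<in> S" "y \<in> S" for x y
    using that frob by (simp_all add: S_def power_mult_distrib)
  have S01: "0 \<in> S" "1 \<in> S" using Q by (simp_all add: S_def)
  have neg: "- x \<in> S" if "x \<in> S" for x
  proof -
    have "0 = (x + (- x)) ^ ?Q" using Q by simp
    also have "\<dots> = x ^ ?Q + (- x) ^ ?Q" by (rule frob)
    also have "\<dots> = x + (- x) ^ ?Q" using that by (simp add: S_def)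
    finally show ?thesis by (simp add: S_def eq_neg_iff_add_eq_0 add.commute)
  qed
  have "inverse x \<in> S" if "x \<in> S" for x using that by (simp add: S_def power_inverse)
  hence inv: "\<exists>y\<in>S. x * y = 1" if "x \<in> S" "x \<noteq> 0" for x using that by (intro bexI[of _ "inverse x"]) auto
  have "field R"
  proof -
    have "cring R"
      by (intro cringI abelian_groupI comm_monoidI)
        (use cl S01 neg in \<open>auto simp: R_def algebra_simps intro!: bexI[of _ "- _"]\<close>)
    thus ?thesis
      by (rule cring.cring_fieldI2) (use inv in \<open>auto simp: R_def\<close>)
  qed
  then interpret R: field R .
  have pow: "x [^]\<^bsub>R\<^esub> (n::nat) = x ^ n" for x n
    by (induction n) (simp_all add: R_def mult.commute)
  obtain a where a: "a \<in> S - {0}" "S - {0} = {a ^ i |i::nat. True}"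
    using R.finite_field_mult_group_has_gen fin pow by (auto simp: R_def)
  interpret G: group "Multiplicative_Group.mult_of R" by (rule R.field_mult_group)
  have powG: "x [^]\<^bsub>Multiplicative_Group.mult_of R\<^esub> (n::nat) = x ^ n" for x n
    using pow by (simp add: Multiplicative_Group.nat_pow_mult_of)
  have carr: "carrier R = S" "\<one>\<^bsub>R\<^esub> = 1" "\<zero>\<^bsub>R\<^esub> = 0" by (simp_all add: R_def)
  have order: "Coset.order (Multiplicative_Group.mult_of R) = ?Q - 1"
    using card fin S01 by (simp add: Coset.order_def carr)
  have "finite (carrier (Multiplicative_Group.mult_of R))"
    "a \<in> carrier (Multiplicative_Group.mult_of R)"
    using fin a(1) by (simp_all add: carr)
  note aG = this
  have "S - {0} = {a ^ i |i. i \<in> {0..G.ord a - 1}}"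
    using G.ord_elems[OF aG] a(2) unfolding powG by simp
  also have "\<dots> = (\<lambda>i. a ^ i) ` {0..G.ord a - 1}" by blast
  finally have "S - {0} = (\<lambda>i. a ^ i) ` {0..G.ord a - 1}" .
  hence "?Q - 1 \<le> card {0..G.ord a - 1}"
    using card_image_le[of "{0..G.ord a - 1}" "\<lambda>i. a ^ i"] order by (simp add: Coset.order_def carr)
  also have "\<dots> = G.ord a" using G.ord_ge_1[OF aG] by simp
  finally have "G.ord a = ?Q - 1"
    using G.ord_le_group_order[OF aG] order by simp
  hence ord: "a ^ k = 1 \<longleftrightarrow> ?Q - 1 dvd k" for k
    using G.pow_eq_id[OF aG(2), of k] by (simp add: carr powG)
  \<comment> \<open>\<open>a\<close> generates the multiplicative group, so \<open>a ^ c\<close> has order \<open>(q\<^sup>2 - 1) / c = N\<close>\<close>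
  obtain c where c: "?Q - 1 = N * c" using N by (elim dvdE)
  have "c > 0" using c Q by (cases c) auto
  hence "(a ^ c) ^ k = 1 \<longleftrightarrow> N dvd k" for k
    using ord[of "c * k", unfolded c] by (simp add: power_mult mult.commute[of N])
  thus thesis by (rule that)
qed

text \<open>
  The powers of \<open>z\<close> already exhaust the at most \<open>k\<close> roots of \<open>X ^ k - 1\<close>.
\<close>

lemma power_of_primitive_root:
  fixes z w :: "'a::field"
  assumes z: "\<And>i. z ^ i = 1 \<longleftrightarrow> k dvd i" and k: "k > 0" and w: "w ^ k = 1"
  shows "\<exists>i. w = z ^ i"
proof -
  define p :: "'a poly" where "p = monom 1 k + [:- 1:]"
  have roots: "{x. poly p x = 0} = {x. x ^ k = 1}" by (simp add: p_def poly_monom)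
  have deg: "degree p = k" unfolding p_def using k by (simp add: degree_add_eq_left degree_monom_eq)
  hence "p \<noteq> 0" using k by auto
  hence fin: "finite {x::'a. x ^ k = 1}" and card: "card {x::'a. x ^ k = 1} \<le> k"
    using poly_roots_finite[of p] card_poly_roots_bound[of p] deg roots by simp_all
  have "z \<noteq> 0" using z[of k] k by (auto simp: power_0_left)
  have *: "i = j" if "i \<le> j" "j < k" "z ^ i = z ^ j" for i j
  proof -
    have "z ^ (j - i) = 1" using that \<open>z \<noteq> 0\<close> by (simp add: power_diff)
    hence "k dvd j - i" using z by blast
    thus "i = j" using that by (auto dest: dvd_imp_le)
  qed
  have "inj_on (\<lambda>i. z ^ i) {..<k}"
  proof (rule inj_onI)
    fix i j assume "i \<in> {..<k}" "j \<in> {..<k}" "z ^ i = z ^ j"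
    thus "i = j" using *[of i j] *[of j i] by (cases "i \<le> j") auto
  qed
  hence "card ((\<lambda>i. z ^ i) ` {..<k}) = k" by (simp add: card_image)
  moreover have "(\<lambda>i. z ^ i) ` {..<k} \<subseteq> {x. x ^ k = 1}"
    using z by (auto simp flip: power_mult)
  ultimately have "(\<lambda>i. z ^ i) ` {..<k} = {x. x ^ k = 1}"
    using fin card by (intro card_seteq) auto
  thus ?thesis using w by blast
qed

section \<open>The algebra generated by a two-by-two matrix\<close>

definition lin :: "'a::field ^ 2 ^ 2 \<Rightarrow> 'a \<Rightarrow> 'a \<Rightarrow> 'a ^ 2 ^ 2" where
  "lin A a b = (\<chi> i j. (if i = j then a else 0) + b * A $ i $ j)"

lemmas matrix2_simps = vec_eq_iff forall_2 sum_2 matrix_matrix_mult_def mat_def lin_def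

lemma lin_0: "lin A c 0 = mat c" and lin_0_1: "lin A 0 1 = A"
  by (simp_all add: matrix2_simps)

lemma uminus_lin: "- lin A a b = lin A (- a) (- b)"
  by (simp add: matrix2_simps)

lemma lin_lin: "lin (lin A a b) c d = lin A (c + d * a) (d * b)"
  by (simp add: matrix2_simps algebra_simps)

text \<open>
  This is the Cayley-Hamilton relation \<open>A\<^sup>2 = trace A * A - 1\<close> for a matrix of determinant 1.
\<close>

lemma lin_mult:
  assumes "det A = 1"
  shows "lin A a b ** lin A c d = lin A (a * c - b * d) (a * d + b * c + b * d * trace A)"
proof -
  have det: "A $ 1 $ 2 * A $ 2 $ 1 = A $ 1 $ 1 * A $ 2 $ 2 - 1"
    using assms by (simp add: det_2 algebra_simps)
  have "b * A $ 1 $ 2 * (d * A $ 2 $ 1) = b * d * (A $ 1 $ 2 * A $ 2 $ 1)"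
    "b * A $ 2 $ 1 * (d * A $ 1 $ 2) = b * d * (A $ 1 $ 2 * A $ 2 $ 1)"
    by (simp_all add: ac_simps)
  note offdiag = this[unfolded det]
  show ?thesis by (simp add: matrix2_simps trace_def offdiag) (simp add: algebra_simps)
qed

lemma det_lin:
  assumes "det A = 1"
  shows "det (lin A a b) = a * a + a * b * trace A + b * b"
proof -
  have "A $ 1 $ 1 * A $ 2 $ 2 - A $ 1 $ 2 * A $ 2 $ 1 = 1" using assms by (simp add: det_2)
  thus ?thesis by (simp add: det_2 lin_def trace_def sum_2) Groebner_Basis.algebra
qed

text \<open>
  The identity matrix and a non-scalar matrix are linearly independent.
\<close>

lemma lin_inject:
  fixes A :: "'a::field ^ 2 ^ 2"
  assumes "\<And>c. A \<noteq> mat c" "lin A a b = lin A c d"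
  shows "a = c \<and> b = d"
proof -
  have eq: "a + b * A $ 1 $ 1 = c + d * A $ 1 $ 1" "a + b * A $ 2 $ 2 = c + d * A $ 2 $ 2"
    "b * A $ 1 $ 2 = d * A $ 1 $ 2" "b * A $ 2 $ 1 = d * A $ 2 $ 1"
    using assms(2) by (simp_all add: matrix2_simps)
  have "b = d"
  proof (rule ccontr)
    assume "b \<noteq> d"
    moreover have "(b - d) * (A $ 1 $ 1 - A $ 2 $ 2) = 0" using eq(1,2) by Groebner_Basis.algebra
    ultimately have "A = mat (A $ 1 $ 1)" using eq(3,4) by (simp add: matrix2_simps)
    thus False using assms(1) by blast
  qed
  thus ?thesis using eq by simp
qed

section \<open>The group PSL(2,q) as matrices up to sign\<close>

lemma scalar_det_1:
  fixes c :: "'a::field"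
  assumes "det (mat c :: 'a ^ 2 ^ 2) = 1"
  shows "c = 1 \<or> c = - 1"
  using assms by (simp add: det_2 mat_def square_eq_1_iff)

lemma mat_uminus: "(mat (- c) :: 'a::ring_1 ^ 'n ^ 'n) = (- mat c :: 'a::ring_1 ^ 'n ^ 'n)"
  by (simp add: vec_eq_iff mat_def)

lemma det_uminus_2: "det (- M) = det (M :: 'a::comm_ring_1 ^ 2 ^ 2)"
  by (simp add: det_2)

text \<open>
  Commuting with the two elementary transvections already forces a matrix to be scalar.
\<close>

lemma center_SL2: "center (SL :: ('a::field ^ 2 ^ 2) monoid) = {mat 1, - mat 1}"
proof
  show "{mat 1, - mat 1} \<subseteq> center (SL :: ('a ^ 2 ^ 2) monoid)"
    by (auto simp: center_def SL_def det_2 matrix2_simps)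
next
  show "center (SL :: ('a ^ 2 ^ 2) monoid) \<subseteq> {mat 1, - mat 1}"
  proof
    fix Z :: "'a ^ 2 ^ 2" assume "Z \<in> center SL"
    hence dZ: "det Z = 1" and comm: "\<And>M. det M = 1 \<Longrightarrow> Z ** M = M ** Z"
      by (auto simp: center_def SL_def)
    let ?U = "vector [vector [1, 1], vector [0, 1]] :: 'a ^ 2 ^ 2"
    let ?V = "vector [vector [1, 0], vector [1, 1]] :: 'a ^ 2 ^ 2"
    have "Z ** ?U = ?U ** Z" "Z ** ?V = ?V ** Z" by (simp_all add: comm det_2)
    hence "Z = mat (Z $ 1 $ 1)" by (auto simp: matrix2_simps)
    thus "Z \<in> {mat 1, - mat 1}" using scalar_det_1 dZ mat_uminus by (metis insertCI)
  qed
qed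

definition psl :: "'a::field ^ 2 ^ 2 \<Rightarrow> ('a ^ 2 ^ 2) set" where
  "psl M = {M, - M}"

lemma coset_center_SL2:
  "center SL #>\<^bsub>SL\<^esub> M = psl (M :: 'a::field ^ 2 ^ 2)"
proof -
  have "- mat 1 ** M = - M" by (simp add: matrix2_simps)
  thus ?thesis unfolding r_coset_def center_SL2 by (auto simp: SL_def psl_def)
qed

lemma carrier_PSL2: "carrier (PSL :: ('a::field ^ 2 ^ 2) set monoid) = psl ` {M. det M = 1}"
  unfolding PSL_def carrier_FactGroup coset_center_SL2 by (simp add: SL_def)

lemma one_PSL2: "\<one>\<^bsub>PSL\<^esub> = psl (mat 1 :: 'a::field ^ 2 ^ 2)"
  unfolding PSL_def by (simp add: center_SL2 psl_def)

lemma PSL2_pow: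
  fixes M :: "'a::field ^ 2 ^ 2"
  assumes "det M = 1"
  shows "psl M [^]\<^bsub>PSL\<^esub> (k::nat) = psl (M [^]\<^bsub>SL\<^esub> k)"
  using normal.FactGroup_pow[OF group.center_normal[OF group_SL], of M k] assms
  unfolding PSL_def coset_center_SL2 by (simp add: SL_def)

lemma finite_PSL2: "finite (carrier (PSL :: ('a::{field,finite} ^ 2 ^ 2) set monoid))"
  by (simp add: carrier_PSL2)

lemma psl_eq_iff: "psl M = psl M' \<longleftrightarrow> M = M' \<or> M = - M'"
  by (auto simp: psl_def doubleton_eq_iff)

lemma psl_scalar:
  fixes c :: "'a::field"
  assumes "det (mat c :: 'a ^ 2 ^ 2) = 1"
  shows "psl (mat c) = \<one>\<^bsub>PSL :: ('a ^ 2 ^ 2) set monoid\<^esub>"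
  using scalar_det_1[OF assms] by (auto simp: one_PSL2 mat_uminus psl_eq_iff)

lemma SL_pow_det: "det M = 1 \<Longrightarrow> det (M [^]\<^bsub>SL\<^esub> (k::nat)) = 1"
  using monoid.nat_pow_closed[OF group.is_monoid[OF group_SL], of M k] by (simp add: SL_def)

section \<open>Eigenvalues and powers\<close>

text \<open>
  By the Cayley-Hamilton relation, sending \<open>lin A a b\<close> to \<open>a + b * l\<close> for an eigenvalue \<open>l\<close> of \<open>A\<close> is
  multiplicative. The image is the eigenvalue of \<open>lin A a b\<close> on the \<open>l\<close>-eigenvectors of \<open>A\<close>.
\<close>

lemma SL_pow_lin:
  fixes A :: "'a::field ^ 2 ^ 2"
  assumes "det A = 1" and l: "l ^ 2 - to_ac (trace A) * l + 1 = 0"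
  shows "\<exists>c d. lin A a b [^]\<^bsub>SL\<^esub> (k::nat) = lin A c d \<and>
    to_ac c + to_ac d * l = (to_ac a + to_ac b * l) ^ k"
proof (induction k)
  case 0
  show ?case by (rule exI[of _ 1], rule exI[of _ 0]) (simp add: SL_def lin_0)
next
  case (Suc k)
  then obtain c d where cd: "lin A a b [^]\<^bsub>SL\<^esub> k = lin A c d"
    "to_ac c + to_ac d * l = (to_ac a + to_ac b * l) ^ k" by blast
  have "lin A a b [^]\<^bsub>SL\<^esub> Suc k = lin A (c * a - d * b) (c * b + d * a + d * b * trace A)"
    using cd lin_mult[OF assms(1), of c d a b] by (simp add: SL_def)
  moreover have "to_ac (c * a - d * b) + to_ac (c * b + d * a + d * b * trace A) * l
      = (to_ac c + to_ac d * l) * (to_ac a + to_ac b * l)"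
    using l by simp Groebner_Basis.algebra
  ultimately show ?case using cd(2) by (metis power_Suc2)
qed

section \<open>Tori and unipotent subgroups\<close>

text \<open>
  The image in PSL(2,q) of the centralizer of a non-scalar matrix \<open>A\<close>. It is a maximal torus when \<open>A\<close>
  has distinct eigenvalues, and a Sylow subgroup of the defining characteristic otherwise.
\<close>

definition torus :: "'a::field ^ 2 ^ 2 \<Rightarrow> ('a ^ 2 ^ 2) set set" where
  "torus A = {psl (lin A a b) | a b. det (lin A a b) = 1}"

lemma torus_subset: "torus A \<subseteq> carrier PSL"
  by (auto simp: torus_def carrier_PSL2)

lemma torus_self: "det A = 1 \<Longrightarrow> psl A \<in> torus A"
  unfolding torus_def by (metis (mono_tags, lifting) lin_0_1 mem_Collect_eq)

lemma quadratic_conj_root: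
  fixes l :: "'a::field"
  assumes "l ^ 2 - t * l + 1 = 0"
  shows "l * (t - l) = 1"
  using assms by (simp add: power2_eq_square algebra_simps)

lemma SL_pow_lin_det:
  fixes A :: "'a::field ^ 2 ^ 2"
  assumes "det A = 1" "l ^ 2 - to_ac (trace A) * l + 1 = 0" "det (lin A a b) = 1"
  obtains c d where "lin A a b [^]\<^bsub>SL\<^esub> (k::nat) = lin A c d" "det (lin A c d) = 1"
    "to_ac c + to_ac d * l = (to_ac a + to_ac b * l) ^ k"
  using SL_pow_lin[OF assms(1,2), of a b k] SL_pow_det[OF assms(3), of k] by metis

lemma exists_eigenvalue:
  fixes A :: "'a::field ^ 2 ^ 2"
  obtains l where "l ^ 2 - to_ac (trace A) * l + 1 = 0"
  using alg_closure_quadratic_root by blast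

text \<open>
  A power of \<open>M\<close> lies in the algebra generated by \<open>M\<close>, and a non-scalar element of that
  two-dimensional algebra generates it again. Hence adjacent non-trivial elements of PSL(2,q)
  determine the same algebra.
\<close>

lemma torus_closed:
  fixes A :: "'a::field ^ 2 ^ 2"
  assumes dA: "det A = 1" and x: "x \<in> torus A" "x \<noteq> \<one>\<^bsub>PSL\<^esub>"
    and y: "y \<noteq> \<one>\<^bsub>PSL\<^esub>" and adj: "power_graph_adj PSL x y"
  shows "y \<in> torus A"
proof -
  obtain a b where ab: "x = psl (lin A a b)" "det (lin A a b) = 1" using x by (auto simp: torus_def)
  have "y \<in> carrier PSL" using adj by (simp add: power_graph_adj_def)
  then obtain B where B: "y = psl B" "det B = 1" by (auto simp: carrier_PSL2)
  obtain l where l: "l ^ 2 - to_ac (trace A) * l + 1 = 0" using exists_eigenvalue by blast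
  obtain l' where l': "l' ^ 2 - to_ac (trace B) * l' + 1 = 0" using exists_eigenvalue by blast
  from adj consider m :: nat where "x = y [^]\<^bsub>PSL\<^esub> m" | m :: nat where "y = x [^]\<^bsub>PSL\<^esub> m"
    by (auto simp: power_graph_adj_def)
  thus ?thesis
  proof cases
    case 2
    obtain c d where cd: "lin A a b [^]\<^bsub>SL\<^esub> m = lin A c d" "det (lin A c d) = 1"
      using SL_pow_lin_det[OF dA l ab(2)] by metis
    have "y = psl (lin A c d)" using 2 ab PSL2_pow[OF ab(2), of m] cd by simp
    thus ?thesis using cd unfolding torus_def by blast
  next
    case 1
    have "det (lin B 0 1) = 1" using B by (simp add: lin_0_1)
    then obtain c d where cd: "B [^]\<^bsub>SL\<^esub> m = lin B c d" "det (lin B c d) = 1"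
      using SL_pow_lin_det[OF B(2) l', of 0 1 m] by (metis lin_0_1)
    have "psl (lin A a b) = psl (lin B c d)" using 1 ab B PSL2_pow[OF B(2), of m] cd by simp
    hence "lin A a b = lin B c d \<or> lin A a b = lin B (- c) (- d)"
      by (simp add: psl_eq_iff uminus_lin)
    then obtain c' d' where cd': "lin A a b = lin B c' d'" by blast
    have "d' \<noteq> 0"
    proof
      assume "d' = 0"
      hence "lin A a b = mat c'" using cd' by (simp add: lin_0)
      thus False using ab x(2) psl_scalar[of c'] by simp
    qed
    hence "B = lin (lin B c' d') (- c' / d') (1 / d')" by (simp add: lin_lin lin_0_1)
    also have "\<dots> = lin A (- c' / d' + 1 / d' * a) (1 / d' * b)" unfolding cd'[symmetric] lin_lin ..
    finally show ?thesis using B unfolding torus_def by blast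
  qed
qed

text \<open>
  Here \<open>e = \<plusminus>1\<close> is the double eigenvalue of \<open>A\<close>, so \<open>A - e\<close> squares to zero and the matrix in question
  is \<open>m + b * (A - e)\<close>. Its \<open>k\<close>-th power is \<open>m ^ k + k * m ^ (k - 1) * b * (A - e)\<close>; the exponent
  \<open>k + 1\<close> may replace \<open>k - 1\<close> as \<open>m\<^sup>2 = 1\<close>, which keeps the formula valid at \<open>k = 0\<close>.
\<close>

lemma unipotent_pow:
  fixes A :: "'a::field ^ 2 ^ 2"
  assumes dA: "det A = 1" and e: "e ^ 2 = 1" "trace A = 2 * e" and m: "m ^ 2 = 1"
  shows "lin A (m - b * e) b [^]\<^bsub>SL\<^esub> (k::nat) =
    lin A (m ^ k - of_nat k * m ^ (k + 1) * b * e) (of_nat k * m ^ (k + 1) * b)"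
proof (induction k)
  case 0
  show ?case by (simp add: SL_def lin_0)
next
  case (Suc k)
  define d where "d = of_nat k * m ^ (k + 1) * b"
  define c where "c = m ^ k - d * e"
  have mm: "m * m = 1" and ee: "e * e = 1" using m e by (simp_all add: power2_eq_square)
  have "d * m = of_nat k * m ^ k * b * (m * m)" by (simp add: d_def ac_simps)
  hence dm: "m ^ k * b + d * m = of_nat (Suc k) * m ^ k * b" by (simp add: mm algebra_simps)
  have m2: "m ^ (Suc k + 1) = m ^ k * (m * m)" by (simp add: ac_simps)
  have "lin A (m - b * e) b [^]\<^bsub>SL\<^esub> Suc k = lin A c d ** lin A (m - b * e) b"
    using Suc by (simp add: SL_def c_def d_def)
  also have "\<dots> = lin A (c * (m - b * e) - d * b) (c * b + d * (m - b * e) + d * b * trace A)"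
    by (rule lin_mult[OF dA])
  also have "c * b + d * (m - b * e) + d * b * trace A = m ^ k * b + d * m"
    by (simp add: e(2) c_def algebra_simps)
  also have "m ^ k * b + d * m = of_nat (Suc k) * m ^ (Suc k + 1) * b"
    by (simp only: dm m2 mm mult_1_right)
  also have "c * (m - b * e) - d * b = m ^ Suc k - (m ^ k * b + d * m) * e + d * b * (e * e) - d * b"
    by (simp add: c_def algebra_simps)
  also have "\<dots> = m ^ Suc k - of_nat (Suc k) * m ^ (Suc k + 1) * b * e"
    by (simp only: ee dm m2 mm mult_1_right) simp
  finally show ?case .
qed

text \<open>
  At the exponent \<open>CHAR('a)\<close> the nilpotent part of the power vanishes and a scalar remains.
\<close>

lemma torus_unipotent:
  fixes A :: "'a::{field,finite} ^ 2 ^ 2"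
  assumes dA: "det A = 1" and l: "l ^ 2 - to_ac (trace A) * l + 1 = 0" "l ^ 2 = 1" and x: "x \<in> torus A"
  shows "x [^]\<^bsub>PSL\<^esub> CHAR('a) = \<one>\<^bsub>PSL\<^esub>"
proof -
  \<comment> \<open>the double eigenvalue is \<open>1\<close> or \<open>- 1\<close> and thus lies in the base field\<close>
  obtain e :: 'a where e: "l = to_ac e" "e ^ 2 = 1"
  proof -
    have "l = to_ac 1 \<or> l = to_ac (- 1)" using l(2) by (simp add: power2_eq_1_iff)
    thus ?thesis using that[of 1] that[of "- 1"] by auto
  qed
  have ee: "e * e = 1" using e by (simp add: power2_eq_square)
  have "to_ac (e ^ 2 - trace A * e + 1) = to_ac 0" using l(1) e(1) by simp
  hence "trace A * e = 2" using e(2) by (simp only: to_ac_eq_iff) (simp add: algebra_simps)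
  hence "trace A * (e * e) = 2 * e" by (simp flip: mult.assoc)
  hence tr: "trace A = 2 * e" by (simp add: ee)
  obtain a b where ab: "x = psl (lin A a b)" "det (lin A a b) = 1" using x by (auto simp: torus_def)
  define m where "m = a + b * e"
  have a: "a = m - b * e" by (simp add: m_def)
  have "m ^ 2 = a * a + a * b * trace A + b * b * (e * e)"
    by (simp add: m_def tr power2_eq_square algebra_simps)
  hence m: "m ^ 2 = 1" using ab(2) det_lin[OF dA, of a b] by (simp add: ee)
  have "lin A a b [^]\<^bsub>SL\<^esub> CHAR('a) = lin A (m ^ CHAR('a)) 0"
    unfolding a using unipotent_pow[OF dA e(2) tr m, of b "CHAR('a)"] by simp
  hence "lin A a b [^]\<^bsub>SL\<^esub> CHAR('a) = mat (m ^ CHAR('a))" by (simp add: lin_0)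
  thus ?thesis
    using ab PSL2_pow[OF ab(2)] SL_pow_det[OF ab(2)] psl_scalar by metis
qed

text \<open>
  The two eigenvalues of a matrix in the algebra are obtained from the two eigenvalues \<open>l\<close> and
  \<open>trace A - l\<close> of \<open>A\<close>, and their product is the determinant.
\<close>

lemma lin_det_factor:
  fixes A :: "'a::field ^ 2 ^ 2"
  assumes dA: "det A = 1" and l: "l ^ 2 - to_ac (trace A) * l + 1 = 0" and ab: "det (lin A a b) = 1"
  shows "(to_ac a + to_ac b * l) * (to_ac a + to_ac b * (to_ac (trace A) - l)) = 1"
proof -
  let ?t = "to_ac (trace A)"
  have "(to_ac a + to_ac b * l) * (to_ac a + to_ac b * (?t - l)) =
      to_ac a * to_ac a + to_ac a * to_ac b * ?t + to_ac b * to_ac b * (l * (?t - l))"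
    by (simp add: algebra_simps)
  also have "\<dots> = to_ac (det (lin A a b))"
    using quadratic_conj_root[OF l] by (simp add: det_lin[OF dA])
  finally show ?thesis using ab by simp
qed

text \<open>
  Squaring removes the sign ambiguity of PSL(2,q). A matrix of determinant 1 is recovered from one
  eigenvalue because the other one is its inverse, and two values at the distinct points \<open>l\<close> and
  \<open>trace A - l\<close> determine the coefficients \<open>a\<close> and \<open>b\<close>.
\<close>

lemma psl_lin_eq_iff:
  fixes A :: "'a::field ^ 2 ^ 2"
  assumes dA: "det A = 1" and ns: "\<And>c. A \<noteq> mat c"
    and l: "l ^ 2 - to_ac (trace A) * l + 1 = 0" "l ^ 2 \<noteq> 1"
    and ab: "det (lin A a b) = 1" and cd: "det (lin A c d) = 1"
  shows "psl (lin A a b) = psl (lin A c d) \<longleftrightarrow>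
    (to_ac a + to_ac b * l) ^ 2 = (to_ac c + to_ac d * l) ^ 2"
proof -
  let ?t = "to_ac (trace A)"
  have conj: "l * (?t - l) = 1" by (rule quadratic_conj_root[OF l(1)])
  have ne: "l \<noteq> ?t - l" using conj l(2) by (metis power2_eq_square)
  have same: "a = c \<and> b = d"
    if eq: "to_ac a + to_ac b * l = to_ac c + to_ac d * l" and cd: "det (lin A c d) = 1" for c d
  proof -
    have "to_ac a + to_ac b * l \<noteq> 0" using lin_det_factor[OF dA l(1) ab] by auto
    hence eq': "to_ac a + to_ac b * (?t - l) = to_ac c + to_ac d * (?t - l)"
      using lin_det_factor[OF dA l(1) ab] lin_det_factor[OF dA l(1) cd] eq
      by (metis mult_left_cancel)
    have "(to_ac b - to_ac d) * (l - (?t - l)) = 0"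
      using arg_cong2[OF eq eq', of "(-)"] by (simp add: algebra_simps)
    hence "b = d" using ne by simp
    thus ?thesis using eq by simp
  qed
  have "det (lin A (- c) (- d)) = 1" using cd det_uminus_2 by (metis uminus_lin)
  hence opp: "a = - c \<and> b = - d" if "to_ac a + to_ac b * l = - (to_ac c + to_ac d * l)"
    using same[of "- c" "- d"] that by simp
  have "to_ac a + to_ac b * l = to_ac c + to_ac d * l \<longleftrightarrow> a = c \<and> b = d"
    using same[of c d] cd by auto
  moreover have "to_ac a + to_ac b * l = - (to_ac c + to_ac d * l) \<longleftrightarrow> a = - c \<and> b = - d"
    using opp by auto
  moreover have "psl (lin A a b) = psl (lin A c d) \<longleftrightarrow> (a = c \<and> b = d) \<or> (a = - c \<and> b = - d)"
    using lin_inject[OF ns, of a b c d] lin_inject[OF ns, of a b "- c" "- d"]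
    by (auto simp: psl_eq_iff uminus_lin)
  ultimately show ?thesis unfolding power2_eq_iff by blast
qed

text \<open>
  The square of the eigenvalue embeds a torus into the multiplicative group of the algebraic
  closure. Working with squares covers even and odd \<open>q\<close> at once: in characteristic 2 squaring is
  injective, otherwise its kernel is exactly the centre that was factored out.
\<close>

lemma torus_embedding:
  fixes A :: "'a::{field,finite} ^ 2 ^ 2"
  assumes dA: "det A = 1" and ns: "\<And>c. A \<noteq> mat c"
    and l: "l ^ 2 - to_ac (trace A) * l + 1 = 0" "l ^ 2 \<noteq> 1"
  obtains s where "inj_on s (torus A)" "s \<one>\<^bsub>PSL\<^esub> = 1" "s (psl A) = l ^ 2"
    "\<And>x k. x \<in> torus A \<Longrightarrow> x [^]\<^bsub>PSL\<^esub> (k::nat) \<in> torus A \<and> s (x [^]\<^bsub>PSL\<^esub> k) = s x ^ k"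
    "\<And>x. x \<in> torus A \<Longrightarrow> \<exists>a b. det (lin A a b) = 1 \<and> s x = (to_ac a + to_ac b * l) ^ 2"
    "\<one>\<^bsub>PSL\<^esub> \<in> torus A"
proof -
  define s where "s = (\<lambda>x. SOME z. \<exists>a b. x = psl (lin A a b) \<and> det (lin A a b) = 1 \<and>
    z = (to_ac a + to_ac b * l) ^ 2)"
  note eq_iff = psl_lin_eq_iff[OF dA ns l]
  have s: "s (psl (lin A a b)) = (to_ac a + to_ac b * l) ^ 2" if "det (lin A a b) = 1" for a b
    unfolding s_def
  proof (rule some_equality)
    show "\<exists>a' b'. psl (lin A a b) = psl (lin A a' b') \<and> det (lin A a' b') = 1 \<and>
      (to_ac a + to_ac b * l) ^ 2 = (to_ac a' + to_ac b' * l) ^ 2"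
      using that by blast
  qed (use eq_iff that in metis)
  have one: "\<one>\<^bsub>PSL\<^esub> = psl (lin A 1 0)" "det (lin A 1 0) = 1" by (simp_all add: one_PSL2 lin_0)
  show thesis
  proof (rule that)
    show "inj_on s (torus A)"
    proof (rule inj_onI)
      fix x y assume xy: "x \<in> torus A" "y \<in> torus A" "s x = s y"
      obtain a b where ab: "x = psl (lin A a b)" "det (lin A a b) = 1" using xy(1) by (auto simp: torus_def)
      obtain c d where cd: "y = psl (lin A c d)" "det (lin A c d) = 1" using xy(2) by (auto simp: torus_def)
      show "x = y" using eq_iff[OF ab(2) cd(2)] s[OF ab(2)] s[OF cd(2)] xy(3) ab(1) cd(1) by simp
    qed
    show "s \<one>\<^bsub>PSL\<^esub> = 1" using s[OF one(2)] one(1) by simp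
    show "s (psl A) = l ^ 2" using s[of 0 1] dA by (simp add: lin_0_1)
    show "\<one>\<^bsub>PSL\<^esub> \<in> torus A" using one unfolding torus_def by blast
  next
    fix x assume "x \<in> torus A"
    then obtain a b where ab: "x = psl (lin A a b)" "det (lin A a b) = 1" by (auto simp: torus_def)
    thus "\<exists>a b. det (lin A a b) = 1 \<and> s x = (to_ac a + to_ac b * l) ^ 2" using s by blast
    fix k :: nat
    obtain c d where cd: "lin A a b [^]\<^bsub>SL\<^esub> k = lin A c d" "det (lin A c d) = 1"
      "to_ac c + to_ac d * l = (to_ac a + to_ac b * l) ^ k" using SL_pow_lin_det[OF dA l(1) ab(2)] by metis
    have "x [^]\<^bsub>PSL\<^esub> k = psl (lin A c d)" using ab cd PSL2_pow[OF ab(2), of k] by simp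
    thus "x [^]\<^bsub>PSL\<^esub> k \<in> torus A \<and> s (x [^]\<^bsub>PSL\<^esub> k) = s x ^ k"
      using s cd ab unfolding torus_def by (auto simp: power_mult[symmetric] mult.commute)
  qed
qed

section \<open>Orders of elements in tori\<close>

text \<open>
  The quotient of \<open>N\<close> by the order \<open>gcd 2 (q - 1)\<close> of the centre of SL(2,q), for \<open>N = q - 1\<close> or
  \<open>N = q + 1\<close>.
\<close>

definition psl_exponent :: "nat \<Rightarrow> nat \<Rightarrow> nat" where
  "psl_exponent q N = (if even q then N else N div 2)"

text \<open>
  This turns the order \<open>N\<close> of an eigenvalue into the order of its square: for even \<open>q\<close> the number \<open>N\<close>
  is odd, for odd \<open>q\<close> it is even.
\<close>

lemma psl_exponent_dvd_iff:
  assumes "q > 0" "N = q - 1 \<or> N = q + 1"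
  shows "N dvd 2 * k \<longleftrightarrow> psl_exponent q N dvd k"
proof (cases "even q")
  case True
  hence "coprime N 2" using assms by auto
  thus ?thesis using True by (simp add: psl_exponent_def coprime_dvd_mult_right_iff)
next
  case False
  hence "even N" using assms by auto
  then obtain n where "N = 2 * n" by (elim evenE)
  thus ?thesis using False by (simp add: psl_exponent_def)
qed

text \<open>
  The Frobenius map \<open>x \<mapsto> x ^ q\<close> fixes the base field, so it sends an eigenvalue \<open>l\<close> of \<open>A\<close> to \<open>l\<close> or to
  the other eigenvalue, which is the inverse. Every eigenvalue \<open>a + b * l\<close> behaves in the same way.
\<close>

lemma torus_exponent:
  fixes A :: "'a::{field,finite} ^ 2 ^ 2"
  assumes pp: "primepow CARD('a)" and dA: "det A = 1"
    and l: "l ^ 2 - to_ac (trace A) * l + 1 = 0"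
  obtains N where "N = CARD('a) - 1 \<or> N = CARD('a) + 1"
    "\<And>a b. det (lin A a b) = 1 \<Longrightarrow> (to_ac a + to_ac b * l) ^ N = 1"
proof -
  let ?q = "CARD('a)" and ?t = "to_ac (trace A)"
  have frob: "(x + y) ^ ?q = x ^ ?q + y ^ ?q" for x y :: "'a alg_closure"
    by (rule alg_closure_frobenius_add[OF pp, of _ 1]) simp
  have fixed: "to_ac c ^ ?q = to_ac c" for c :: 'a
    using alg_closure_fixed_iff[of "to_ac c"] by simp
  have mu: "(to_ac a + to_ac b * l) ^ ?q = to_ac a + to_ac b * l ^ ?q" for a b
    by (simp only: frob power_mult_distrib fixed)
  have q: "?q = Suc (?q - 1)" using pp primepow_gt_0_nat by force
  have "l ^ 2 + 1 = ?t * l" using l by (simp add: algebra_simps)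
  hence "(l ^ 2 + 1) ^ ?q = (?t * l) ^ ?q" by simp
  hence "(l ^ 2) ^ ?q + 1 = ?t * l ^ ?q" by (simp only: frob power_mult_distrib fixed power_one)
  hence "(l ^ ?q) ^ 2 + 1 = ?t * l ^ ?q" by (simp only: power_mult[symmetric] mult.commute)
  moreover have "(l ^ ?q - l) * (l ^ ?q - (?t - l)) = (l ^ ?q) ^ 2 - ?t * l ^ ?q + l * (?t - l)"
    by (simp add: power2_eq_square algebra_simps)
  \<comment> \<open>\<open>l ^ q\<close> is a root of the same quadratic polynomial\<close>
  ultimately have "(l ^ ?q - l) * (l ^ ?q - (?t - l)) = 0"
    using quadratic_conj_root[OF l] by (simp add: algebra_simps)
  then consider "l ^ ?q = l" | "l ^ ?q = ?t - l" by auto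
  thus thesis
  proof cases
    case 1
    show thesis
    proof (rule that[of "?q - 1"])
      fix a b assume ab: "det (lin A a b) = 1"
      let ?m = "to_ac a + to_ac b * l"
      have "?m \<noteq> 0" using lin_det_factor[OF dA l ab] by auto
      moreover have "?m * ?m ^ (?q - 1) = ?m ^ ?q" by (metis power_Suc q)
      ultimately show "?m ^ (?q - 1) = 1" using mu[of a b] 1 by simp
    qed simp
  next
    case 2
    show thesis
      by (rule that[of "?q + 1"]) (use lin_det_factor[OF dA l] mu 2 in \<open>simp_all add: mult.commute\<close>)
  qed
qed

text \<open>
  Both claims transfer from the multiplicative group of a field, where an element whose order
  divides that of \<open>z\<close> is a power of \<open>z\<close>.
\<close>

lemma torus_cyclic:
  fixes A :: "'a::{field,finite} ^ 2 ^ 2"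
  assumes pp: "primepow CARD('a)" and dA: "det A = 1" and ns: "\<And>c. A \<noteq> mat c"
    and l: "l ^ 2 - to_ac (trace A) * l + 1 = 0" "l ^ 2 \<noteq> 1"
  obtains N where "N = CARD('a) - 1 \<or> N = CARD('a) + 1"
    "\<And>x. x \<in> torus A \<Longrightarrow> x [^]\<^bsub>PSL\<^esub> psl_exponent CARD('a) N = \<one>\<^bsub>PSL\<^esub>"
    "\<And>x y. x \<in> torus A \<Longrightarrow> y \<in> torus A \<Longrightarrow> group.ord PSL x dvd group.ord PSL y \<Longrightarrow>
      \<exists>m::nat. x = y [^]\<^bsub>PSL\<^esub> m"
proof -
  interpret G: group "PSL :: ('a ^ 2 ^ 2) set monoid" by (rule group_PSL)
  have q0: "CARD('a) > 0" by simp
  obtain N where N: "N = CARD('a) - 1 \<or> N = CARD('a) + 1"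
    and expo: "\<And>a b. det (lin A a b) = 1 \<Longrightarrow> (to_ac a + to_ac b * l) ^ N = 1"
    using torus_exponent[OF pp dA l(1)] by metis
  obtain s where s: "inj_on s (torus A)" "s \<one>\<^bsub>PSL\<^esub> = 1" "\<one>\<^bsub>PSL\<^esub> \<in> torus A"
    "\<And>x k. x \<in> torus A \<Longrightarrow> x [^]\<^bsub>PSL\<^esub> (k::nat) \<in> torus A \<and> s (x [^]\<^bsub>PSL\<^esub> k) = s x ^ k"
    "\<And>x. x \<in> torus A \<Longrightarrow> \<exists>a b. det (lin A a b) = 1 \<and> s x = (to_ac a + to_ac b * l) ^ 2"
    using torus_embedding[OF dA ns l] by metis
  have one_iff: "x [^]\<^bsub>PSL\<^esub> k = \<one>\<^bsub>PSL\<^esub> \<longleftrightarrow> s x ^ k = 1" if "x \<in> torus A" for x and k :: nat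
    using s(1-3) s(4)[OF that, of k] by (metis inj_onD)
  show thesis
  proof (rule that[OF N])
    fix x assume x: "x \<in> torus A"
    obtain a b where ab: "det (lin A a b) = 1" "s x = (to_ac a + to_ac b * l) ^ 2" using s(5)[OF x] by blast
    have "N dvd 2 * psl_exponent CARD('a) N" using psl_exponent_dvd_iff[OF q0 N] by simp
    then obtain c where "2 * psl_exponent CARD('a) N = N * c" by (elim dvdE)
    hence "s x ^ psl_exponent CARD('a) N = 1"
      using expo[OF ab(1)] by (simp add: ab(2) flip: power_mult) (simp add: power_mult)
    thus "x [^]\<^bsub>PSL\<^esub> psl_exponent CARD('a) N = \<one>\<^bsub>PSL\<^esub>" using one_iff[OF x] by blast
  next
    fix x y assume xy: "x \<in> torus A" "y \<in> torus A" and dvd: "G.ord x dvd G.ord y"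
    have xy': "x \<in> carrier PSL" "y \<in> carrier PSL" using xy torus_subset by blast+
    have "s y ^ i = 1 \<longleftrightarrow> G.ord y dvd i" for i
      using one_iff[OF xy(2)] G.pow_eq_id[OF xy'(2)] by blast
    moreover have "G.ord y > 0" using G.ord_ge_1[OF finite_PSL2 xy'(2)] by simp
    moreover have "s x ^ G.ord y = 1"
      using one_iff[OF xy(1)] G.pow_eq_id[OF xy'(1)] dvd by blast
    ultimately obtain i where "s x = s y ^ i" using power_of_primitive_root[of "s y" "G.ord y" "s x"] by blast
    hence "s x = s (y [^]\<^bsub>PSL\<^esub> i)" using s(4)[OF xy(2)] by simp
    hence "x = y [^]\<^bsub>PSL\<^esub> i" using s(1) s(4)[OF xy(2)] xy(1) by (metis inj_onD)
    thus "\<exists>m::nat. x = y [^]\<^bsub>PSL\<^esub> m" by blast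
  qed
qed

text \<open>
  If \<open>l\<close> has order \<open>N\<close>, then \<open>l + 1 / l\<close> is fixed by the Frobenius map and lies in the base field. The
  companion matrix with this trace has eigenvalue \<open>l\<close>, and its order modulo sign is the order of
  \<open>l\<^sup>2\<close>. The last assumption amounts to \<open>l\<^sup>2 \<noteq> 1\<close>, so that the eigenvalues \<open>l\<close> and \<open>1 / l\<close> are distinct.
\<close>

lemma exists_element_of_order:
  assumes pp: "primepow CARD('a::{field,finite})" and N: "N = CARD('a) - 1 \<or> N = CARD('a) + 1"
    and n: "psl_exponent CARD('a) N \<noteq> 1"
  shows "\<exists>x\<in>carrier (PSL :: ('a ^ 2 ^ 2) set monoid). group.ord PSL x = psl_exponent CARD('a) N"
proof -
  interpret G: group "PSL :: ('a ^ 2 ^ 2) set monoid" by (rule group_PSL)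
  let ?q = "CARD('a)"
  have q0: "?q > 0" by simp
  have "?q ^ 2 - 1 = (?q - 1) * (?q + 1)" using q0 by (simp add: power2_eq_square algebra_simps)
  hence "N dvd ?q ^ 2 - 1" using N by (metis dvd_triv_left dvd_triv_right)
  then obtain l :: "'a alg_closure" where ord: "\<And>k. l ^ k = 1 \<longleftrightarrow> N dvd k"
    using alg_closure_root_of_unity[OF pp] by metis
  have l0: "l \<noteq> 0"
  proof
    assume "l = 0"
    hence "N = 0" using ord[of N] by (cases "N = 0") (auto simp: power_0_left)
    thus False using N primepow_gt_Suc_0[OF pp] by auto
  qed
  have dvd2: "l ^ (2 * k) = 1 \<longleftrightarrow> psl_exponent ?q N dvd k" for k
    using ord psl_exponent_dvd_iff[OF q0 N] by simp
  have l2: "l ^ 2 \<noteq> 1" using dvd2[of 1] n by simp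
  have lq: "l ^ ?q = l \<or> l ^ ?q = 1 / l"
  proof -
    have "l ^ N = 1" by (simp add: ord)
    have "?q = Suc (?q - 1)" using q0 by simp
    hence "l ^ ?q = l * l ^ (?q - 1)" by (metis power_Suc)
    thus ?thesis using N \<open>l ^ N = 1\<close> l0 by (auto simp: field_simps)
  qed
  have "(l + 1 / l) ^ ?q = l ^ ?q + (1 / l) ^ ?q"
    by (rule alg_closure_frobenius_add[OF pp, of _ 1]) simp
  also have "\<dots> = l + 1 / l" using lq by (auto simp: power_divide)
  finally obtain t :: 'a where t: "l + 1 / l = to_ac t" using alg_closure_fixed_iff by blast
  define A :: "'a ^ 2 ^ 2" where "A = vector [vector [0, - 1], vector [1, t]]"
  have A: "det A = 1" "trace A = t" by (simp_all add: A_def det_2 trace_def sum_2)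
  have ns: "A \<noteq> mat c" for c
  proof
    assume "A = mat c"
    hence "A $ 2 $ 1 = (mat c :: 'a ^ 2 ^ 2) $ 2 $ 1" by simp
    thus False by (simp add: A_def mat_def)
  qed
  have "(l + 1 / l) * l = l ^ 2 + 1"
    using l0 by (simp add: distrib_right power2_eq_square)
  hence "l ^ 2 - to_ac (trace A) * l + 1 = 0" by (simp add: A(2) t)
  from torus_embedding[OF A(1) ns this l2]
  obtain s where s: "inj_on s (torus A)" "s \<one>\<^bsub>PSL\<^esub> = 1" "s (psl A) = l ^ 2" "\<one>\<^bsub>PSL\<^esub> \<in> torus A"
    "\<And>x k. x \<in> torus A \<Longrightarrow> x [^]\<^bsub>PSL\<^esub> (k::nat) \<in> torus A \<and> s (x [^]\<^bsub>PSL\<^esub> k) = s x ^ k"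
    by metis
  have T: "psl A \<in> torus A" by (rule torus_self[OF A(1)])
  have C: "psl A \<in> carrier PSL" using T torus_subset by blast
  have "psl A [^]\<^bsub>PSL\<^esub> k = \<one>\<^bsub>PSL\<^esub> \<longleftrightarrow> psl_exponent ?q N dvd k" for k
  proof -
    have "psl A [^]\<^bsub>PSL\<^esub> k = \<one>\<^bsub>PSL\<^esub> \<longleftrightarrow> s (psl A [^]\<^bsub>PSL\<^esub> k) = s \<one>\<^bsub>PSL\<^esub>"
      using s(1,4) s(5)[OF T] by (metis inj_onD)
    thus ?thesis using s(2,3) s(5)[OF T, of k] dvd2[of k] by (simp add: power_mult)
  qed
  hence "G.ord (psl A) = psl_exponent ?q N" using G.ord_unique[OF C] by blast
  thus ?thesis using C by blast
qed

section \<open>Chordality of the power graph of PSL(2,q)\<close>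

theorem theorem5p2:
  fixes q :: nat
  assumes "primepow q"
    and "CARD('a::{field,finite}) = q"
  shows "chordal_power_graph (PSL :: ('a ^ 2 ^ 2) set monoid) \<longleftrightarrow>
    (even q \<longrightarrow>
       (primepow_or_one (q + 1) \<or> prime_times_primepow (q + 1)) \<and>
       (primepow_or_one (q - 1) \<or> prime_times_primepow (q - 1))) \<and>
    (odd q \<longrightarrow>
       (primepow_or_one ((q + 1) div 2) \<or> prime_times_primepow ((q + 1) div 2)) \<and>
       (primepow_or_one ((q - 1) div 2) \<or> prime_times_primepow ((q - 1) div 2)))"
proof -
  interpret G: group "PSL :: ('a ^ 2 ^ 2) set monoid" by (rule group_PSL)
  have pp: "primepow CARD('a)" using assms by simp
  define good where "good n \<longleftrightarrow> primepow_or_one n \<or> prime_times_primepow n" for n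
  have "chordal_power_graph (PSL :: ('a ^ 2 ^ 2) set monoid) \<longleftrightarrow>
    (\<forall>N. N = q - 1 \<or> N = q + 1 \<longrightarrow> good (psl_exponent q N))"
  proof (intro iffI allI impI)
    fix N assume ch: "chordal_power_graph (PSL :: ('a ^ 2 ^ 2) set monoid)" and N: "N = q - 1 \<or> N = q + 1"
    show "good (psl_exponent q N)"
    proof (cases "psl_exponent q N = 1")
      case True
      thus ?thesis unfolding good_def primepow_or_one_def by (metis power_0 two_is_prime_nat)
    next
      case False
      then obtain x where x: "x \<in> carrier (PSL :: ('a ^ 2 ^ 2) set monoid)" "G.ord x = psl_exponent q N"
        using exists_element_of_order[OF pp, of N] N assms(2) by auto
      have "G.ord x > 0" using G.ord_ge_1[OF finite_PSL2 x(1)] by simp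
      thus ?thesis using G.prime_times_primepow_ord_of_chordal[OF ch x(1)] x(2) by (simp add: good_def)
    qed
  next
    assume good: "\<forall>N. N = q - 1 \<or> N = q + 1 \<longrightarrow> good (psl_exponent q N)"
    \<comment> \<open>Two members of this family that share a non-trivial element coincide.\<close>
    define F where "F = {torus A | A :: 'a ^ 2 ^ 2. det A = 1 \<and> (\<forall>c. A \<noteq> mat c)}"
    show "chordal_power_graph (PSL :: ('a ^ 2 ^ 2) set monoid)"
    proof (rule G.chordal_power_graph_of_partition[OF finite_PSL2, of F])
      fix x :: "('a ^ 2 ^ 2) set" assume x: "x \<in> carrier PSL" "x \<noteq> \<one>\<^bsub>PSL\<^esub>"
      obtain A where A: "x = psl A" "det A = 1" using x(1) by (auto simp: carrier_PSL2)
      have "A \<noteq> mat c" for c using A x(2) psl_scalar[of c] by auto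
      hence "torus A \<in> F" using A(2) unfolding F_def by blast
      thus "\<exists>K\<in>F. x \<in> K" using torus_self[OF A(2)] A(1) by blast
    next
      fix K x y assume "K \<in> F" "x \<in> K" "x \<noteq> \<one>\<^bsub>PSL\<^esub>" "y \<noteq> \<one>\<^bsub>PSL\<^esub>" "power_graph_adj PSL x y"
      thus "y \<in> K" using torus_closed by (auto simp: F_def)
    next
      fix K assume "K \<in> F"
      then obtain A :: "'a ^ 2 ^ 2" where K: "K = torus A" and A: "det A = 1" "\<And>c. A \<noteq> mat c"
        unfolding F_def by blast
      obtain l where l: "l ^ 2 - to_ac (trace A) * l + 1 = 0" using exists_eigenvalue by blast
      show "(\<exists>p::nat. prime p \<and> (\<forall>x\<in>K. x [^]\<^bsub>PSL\<^esub> p = \<one>\<^bsub>PSL\<^esub>)) \<or>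
        (\<exists>n. (primepow_or_one n \<or> prime_times_primepow n) \<and> (\<forall>x\<in>K. x [^]\<^bsub>PSL\<^esub> n = \<one>\<^bsub>PSL\<^esub>) \<and>
          (\<forall>x\<in>K. \<forall>y\<in>K. G.ord x dvd G.ord y \<longrightarrow> (\<exists>m::nat. x = y [^]\<^bsub>PSL\<^esub> m)))"
      proof (cases "l ^ 2 = 1")
        case True
        have "prime CHAR('a)" by (rule CARD_eq_CHAR_power[OF pp])
        thus ?thesis
          using torus_unipotent[OF A(1) l True] unfolding K
          by (intro disjI1 exI[of _ "CHAR('a)"]) simp
      next
        case False
        obtain N where N: "N = q - 1 \<or> N = q + 1"
          "\<And>x. x \<in> K \<Longrightarrow> x [^]\<^bsub>PSL\<^esub> psl_exponent q N = \<one>\<^bsub>PSL\<^esub>"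
          "\<And>x y. x \<in> K \<Longrightarrow> y \<in> K \<Longrightarrow> G.ord x dvd G.ord y \<Longrightarrow> \<exists>m::nat. x = y [^]\<^bsub>PSL\<^esub> m"
          by (rule torus_cyclic[OF pp A l False, unfolded assms(2), folded K]) (rule that)
        have "good (psl_exponent q N)" using good N(1) by blast
        thus ?thesis using N(2,3) unfolding good_def by blast
      qed
    qed
  qed
  also have "\<dots> \<longleftrightarrow> good (psl_exponent q (q + 1)) \<and> good (psl_exponent q (q - 1))" by blast
  finally show ?thesis by (cases "even q") (simp_all add: good_def psl_exponent_def)
qed

end
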